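(* Let $U\subset \mathbb R$ be an interval and suppose that $\varphi\in C^{1,1}(U) \cap C^{2,\alpha}_{loc}(U)$ for some $\alpha>0$. Let $u\in \mathscr S(\mathbb R^n)$ be such that $u(\mathbb R^n)\subset U$. For $s\in(0,1)$ and $x\in\mathbb R^n$ one has $$(-\Delta)^s \varphi(u(x)) = \varphi'(u(x)) (-\Delta)^s u(x) - \varphi''(u(x)) \Gamma_{(s)}(u)(x) + \mathscr R_{(s)}(u;\varphi)(x),$$ where the remainder $\mathscr R_{(s)}(u;\varphi)(x)$ (which is determined by this identity) satisfies, for every $x\in \mathbb R^n$, $$\lim_{s\to 1^-} \mathscr R_{(s)}(u;\varphi)(x) = 0.$$ If $\varphi(t) = a t^2 + bt + c$ (with $a,b,c\in\mathbb R$), then $\mathscr R_{(s)}(u;\varphi) \equiv 0$. As a consequence, for every $x\in\mathbb R^n$, $$- \lim_{s\to 1^-} (-\Delta)^s \varphi(u(x)) = \varphi'(u(x)) \Delta u(x) + \varphi''(u(x)) |\nabla u(x)|^2.$$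
   Context: $\mathscr S(\mathbb R^n)$ is the Schwartz space of (real-valued) functions on $\mathbb R^n$. $C^{1,1}(U)$ denotes the $C^1$ functions on $U$ whose derivative is Lipschitz on $U$ (so that $\varphi''\in L^\infty(U)$ for $\varphi\in C^{1,1}(U)\cap C^2(U)$), and $C^{2,\alpha}_{loc}(U)$ the $C^2$ functions on $U$ whose second derivative is locally $\alpha$-Hölder continuous. For $0<s<1$ the fractional Laplacian of a function $w$ is defined by $$(-\Delta)^s w(x) = \frac{\gamma(n,s)}{2} \int_{\mathbb R^n} \frac{2 w(x) - w(x+y) - w(x-y)}{|y|^{n+2s}}\, dy,\qquad \gamma(n,s) = \frac{s 2^{2s} \Gamma\left(\frac{n+ 2s}{2}\right)}{\pi^{\frac n2} \Gamma(1-s)},$$ where $\Gamma(\cdot)$ is the Euler gamma function; $(-\Delta)^s\varphi(u(x))$ means $(-\Delta)^s(\varphi\circ u)(x)$. The nonlocal carré du champ is $$\Gamma_{(s)}(u)(x) = \frac{\gamma(n,s)}{2} \int_{\mathbb R^n} \frac{(u(x) - u(y))^2}{|x-y|^{n + 2s}}\, dy .$$ *)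

theory Defs
  imports "HOL-Analysis.Analysis"
begin

section \<open>Function classes on an interval\<close>

text \<open>Derivatives are taken within \<open>U\<close>, so they are one-sided at those endpoints that belong to
  \<open>U\<close>, and the values of \<open>f\<close> outside \<open>U\<close> play no role.\<close>

definition deriv_within :: "real set \<Rightarrow> (real \<Rightarrow> real) \<Rightarrow> real \<Rightarrow> real" where
  "deriv_within U f t = vector_derivative f (at t within U)"

definition C1_on :: "real set \<Rightarrow> (real \<Rightarrow> real) \<Rightarrow> bool" where
  "C1_on U f \<longleftrightarrow> f differentiable_on U \<and> continuous_on U (deriv_within U f)"

definition C2_on :: "real set \<Rightarrow> (real \<Rightarrow> real) \<Rightarrow> bool" where
  "C2_on U f \<longleftrightarrow> C1_on U f \<and> C1_on U (deriv_within U f)"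

definition C11_on :: "real set \<Rightarrow> (real \<Rightarrow> real) \<Rightarrow> bool" where
  "C11_on U f \<longleftrightarrow> C1_on U f \<and> (\<exists>L. L-lipschitz_on U (deriv_within U f))"

definition locally_holder_on :: "real \<Rightarrow> real set \<Rightarrow> (real \<Rightarrow> real) \<Rightarrow> bool" where
  "locally_holder_on \<alpha> U f \<longleftrightarrow>
     (\<forall>K. compact K \<and> K \<subseteq> U \<longrightarrow> (\<exists>C. \<forall>x\<in>K. \<forall>y\<in>K. \<bar>f x - f y\<bar> \<le> C * \<bar>x - y\<bar> powr \<alpha>))"

definition C2_holder_loc_on :: "real \<Rightarrow> real set \<Rightarrow> (real \<Rightarrow> real) \<Rightarrow> bool" where
  "C2_holder_loc_on \<alpha> U f \<longleftrightarrow>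
     C2_on U f \<and> locally_holder_on \<alpha> U (deriv_within U (deriv_within U f))"

section \<open>Partial derivatives and Schwartz functions\<close>

definition partial_deriv :: "'n \<Rightarrow> (real ^ 'n \<Rightarrow> real) \<Rightarrow> real ^ 'n \<Rightarrow> real" where
  "partial_deriv i u x = deriv (\<lambda>t. u (x + t *\<^sub>R axis i 1)) 0"

definition grad :: "(real ^ 'n \<Rightarrow> real) \<Rightarrow> real ^ 'n \<Rightarrow> real ^ 'n" where
  "grad u x = (\<chi> i. partial_deriv i u x)"

definition laplacian :: "(real ^ 'n::finite \<Rightarrow> real) \<Rightarrow> real ^ 'n \<Rightarrow> real" where
  "laplacian u x = (\<Sum>i\<in>UNIV. partial_deriv i (partial_deriv i u) x)"

text \<open>A partial derivative of arbitrary order is given by the list of coordinate directions in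
  which one differentiates. Since \<^const>\<open>deriv\<close> is a total operator, differentiability of all these
  functions is what expresses that \<open>u\<close> is of class \<open>C\<^sup>\<infinity>\<close>.\<close>

definition iter_partial :: "'n list \<Rightarrow> (real ^ 'n \<Rightarrow> real) \<Rightarrow> real ^ 'n \<Rightarrow> real" where
  "iter_partial js u = foldr partial_deriv js u"

definition smooth :: "(real ^ 'n::finite \<Rightarrow> real) \<Rightarrow> bool" where
  "smooth u \<longleftrightarrow> (\<forall>js. iter_partial js u differentiable_on UNIV)"

definition schwartz_space :: "(real ^ 'n::finite \<Rightarrow> real) set" where
  "schwartz_space = {u. smooth u \<and>
     (\<forall>(m :: 'n \<Rightarrow> nat) js. bounded (range (\<lambda>x. (\<Prod>i\<in>UNIV. (x $ i) ^ m i) * iter_partial js u x)))}"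

section \<open>The fractional Laplacian and the nonlocal carre du champ\<close>

definition frac_const :: "nat \<Rightarrow> real \<Rightarrow> real" where
  "frac_const n s =
     s * 2 powr (2 * s) * Gamma ((real n + 2 * s) / 2) / (pi powr (real n / 2) * Gamma (1 - s))"

definition frac_laplacian_integrand ::
    "real \<Rightarrow> (real ^ 'n::finite \<Rightarrow> real) \<Rightarrow> real ^ 'n \<Rightarrow> real ^ 'n \<Rightarrow> real" where
  "frac_laplacian_integrand s w x y =
     (2 * w x - w (x + y) - w (x - y)) / norm y powr (real CARD('n) + 2 * s)"

text \<open>This is the operator \<open>(-\<Delta>)\<^sup>s\<close> (with its sign).\<close>

definition frac_laplacian :: "real \<Rightarrow> (real ^ 'n::finite \<Rightarrow> real) \<Rightarrow> real ^ 'n \<Rightarrow> real" where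
  "frac_laplacian s w x =
     frac_const CARD('n) s / 2 * (LINT y|lborel. frac_laplacian_integrand s w x y)"

definition carre_du_champ_integrand ::
    "real \<Rightarrow> (real ^ 'n::finite \<Rightarrow> real) \<Rightarrow> real ^ 'n \<Rightarrow> real ^ 'n \<Rightarrow> real" where
  "carre_du_champ_integrand s u x y =
     (u x - u y)\<^sup>2 / norm (x - y) powr (real CARD('n) + 2 * s)"

definition carre_du_champ :: "real \<Rightarrow> (real ^ 'n::finite \<Rightarrow> real) \<Rightarrow> real ^ 'n \<Rightarrow> real" where
  "carre_du_champ s u x =
     frac_const CARD('n) s / 2 * (LINT y|lborel. carre_du_champ_integrand s u x y)"

text \<open>The remainder is whatever makes the nonlocal chain rule an identity.\<close>

definition chain_remainder ::
    "real set \<Rightarrow> real \<Rightarrow> (real ^ 'n::finite \<Rightarrow> real) \<Rightarrow> (real \<Rightarrow> real) \<Rightarrow> real ^ 'n \<Rightarrow> real" where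
  "chain_remainder U s u \<phi> x =
     frac_laplacian s (\<phi> \<circ> u) x
     - (deriv_within U \<phi> (u x) * frac_laplacian s u x
        - deriv_within U (deriv_within U \<phi>) (u x) * carre_du_champ s u x)"

end

theory Submission
  imports Defs "HOL-Combinatorics.Transposition"
begin

text \<open>All three nonlocal quantities have the form
  \<open>\<gamma>(n,s)/2 \<integral> F(y) / |y|\<^bsup>n+2s\<^esup> dy\<close> with \<open>F\<close> bounded and
  \<open>F(y) = \<Sum> A\<^sub>i\<^sub>j y\<^sub>i y\<^sub>j + o(|y|\<^sup>2)\<close>. Since \<open>\<gamma>(n,s)\<close> vanishes like \<open>1 - s\<close> with the
  constant dictated by the volume of the unit ball, such an expression tends to the trace of \<open>A\<close>
  as \<open>s \<rightarrow> 1\<close>. Expanding \<open>\<phi>\<close> to second order at \<open>u(x)\<close> identifies the remainder as such an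
  expression whose \<open>F\<close> is a sum of two Taylor remainders at \<open>u(x \<plusminus> y)\<close>, hence with \<open>A = 0\<close>,
  and with \<open>F = 0\<close> when \<open>\<phi>\<close> is quadratic.\<close>

section \<open>Radial integrals and symmetries of Lebesgue measure\<close>

text \<open>The rates match because \<open>Gamma (1 - s) = Gamma (2 - s) / (1 - s)\<close>: hence
  \<open>frac_const n s\<close> is \<open>1 - s\<close> times a factor tending to
  \<open>4 / V\<close>, with \<open>V\<close> the volume of the unit ball, while each
  \<open>y_i^2\<close> integrates to \<open>V / (2 - 2 * s)\<close> against the kernel over the unit
  ball. Half the first times the second tends to 1. The quadratic terms of the expansions at
  \<open>x + y\<close> and \<open>x - y\<close> give two squared differences, each weighted by half
  of the second derivative of \<phi>. Reflection identifies their integrals, which is why exactly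
  one carre du champ appears. The obstacle is the global bound on \<open>F\<close>: \<open>U\<close>
  need not contain its endpoints, so values of \<open>u\<close> may accumulate outside
  \<open>U\<close>, and compactness does not bound \<phi> on \<open>range u\<close>. The Lipschitz
  bound on the first derivative does.\<close>

lemma distr_norm_lborel:
  "distr lborel borel (norm :: 'a::euclidean_space \<Rightarrow> real) =
     density lborel (\<lambda>r. ennreal (indicator {0..} r *
       (real DIM('a) * unit_ball_vol (real DIM('a)) * r ^ (DIM('a) - 1))))"
    (is "?M = density lborel (\<lambda>r. ennreal (?d r))")
\<comment> \<open>Half-lines form an intersection-stable generator. On \<open>{..r}\<close> both
  measures equal the volume \<open>V * r ^ n\<close> of a ball, and the density is the derivative of
  this volume in \<open>r\<close>.\<close>
proof (rule measure_eqI_generator_eq)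
  let ?n = "DIM('a)"
  let ?E = "range (\<lambda>a::real. {..a})"
  show "Int_stable ?E"
    by (auto simp: Int_stable_def Int_atMost)
  show sets: "sets ?M = sigma_sets UNIV ?E" "sets (density lborel (\<lambda>r. ennreal (?d r))) = sigma_sets UNIV ?E"
    using arg_cong[OF borel_eq_atMost[where 'a=real], of sets] by simp_all
  have eq: "emeasure ?M {..r} = ennreal (if r < 0 then 0 else unit_ball_vol ?n * r ^ ?n)" for r
  proof -
    have "emeasure ?M {..r} = emeasure lborel (cball (0::'a) r)"
      by (subst emeasure_distr) (auto simp: intro!: arg_cong[where f="emeasure lborel"])
    then show ?thesis
      by (cases "r < 0") (simp_all add: emeasure_cball)
  qed
  have "emeasure (density lborel (\<lambda>r. ennreal (?d r))) {..r} =
      ennreal (if r < 0 then 0 else unit_ball_vol ?n * r ^ ?n)" for r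
  proof -
    have "emeasure (density lborel (\<lambda>r. ennreal (?d r))) {..r} =
        (\<integral>\<^sup>+t. ennreal (?d t) * indicator {..r} t \<partial>lborel)"
      by (subst emeasure_density) auto
    also have "\<dots> = (\<integral>\<^sup>+t. ennreal (real ?n * unit_ball_vol ?n * t ^ (?n - 1)) * indicator {0..r} t \<partial>lborel)"
      by (intro nn_integral_cong) (auto simp: indicator_def)
    also have "\<dots> = ennreal (if r < 0 then 0 else unit_ball_vol ?n * r ^ ?n)"
    proof (cases "r < 0")
      case False
      have "((\<lambda>t. real ?n * unit_ball_vol ?n * t ^ (?n - 1)) has_integral
          unit_ball_vol ?n * r ^ ?n - unit_ball_vol ?n * 0 ^ ?n) {0..r}"
        using False by (intro fundamental_theorem_of_calculus)
          (auto simp flip: has_real_derivative_iff_has_vector_derivative intro!: derivative_eq_intros)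
      then have "((\<lambda>t. real ?n * unit_ball_vol ?n * t ^ (?n - 1)) has_integral
          unit_ball_vol ?n * r ^ ?n) {0..r}"
        by (simp add: power_0_left)
      then show ?thesis
        using False by (subst nn_integral_has_integral_lebesgue') auto
    qed simp
    finally show ?thesis .
  qed
  with eq show "emeasure ?M X = emeasure (density lborel (\<lambda>r. ennreal (?d r))) X" if "X \<in> ?E" for X
    using that by auto
  show "range (\<lambda>i::nat. {..real i}) \<subseteq> ?E" "(\<Union>i::nat. {..real i}) = UNIV"
    by (auto intro: real_arch_simple)
  show "emeasure ?M {..real i} \<noteq> \<infinity>" for i
    by (simp add: eq)
qed auto

text \<open>Polar coordinates, phrased with \<open>has_bochner_integral\<close> so that
  integrability of the singular kernels and the value of their integrals come together.\<close>

lemma has_bochner_integral_radial: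
  fixes f :: "real \<Rightarrow> real"
  assumes [measurable]: "f \<in> borel_measurable borel"
    and I: "has_bochner_integral lborel
      (\<lambda>r. indicator {0..} r * (r ^ (DIM('a) - 1) * f r)) I"
  shows "has_bochner_integral lborel (\<lambda>y::'a::euclidean_space. f (norm y))
      (real DIM('a) * unit_ball_vol (real DIM('a)) * I)"
proof -
  let ?c = "real DIM('a) * unit_ball_vol (real DIM('a))"
  have "has_bochner_integral lborel
      (\<lambda>r. (indicator {0..} r * (?c * r ^ (DIM('a) - 1))) *\<^sub>R f r) (?c * I)"
    using has_bochner_integral_mult_right[OF I, of ?c] by (simp add: algebra_simps)
  then have "has_bochner_integral (distr lborel borel (norm :: 'a \<Rightarrow> real)) f (?c * I)"
    unfolding distr_norm_lborel
    by (intro has_bochner_integral_density) (auto simp: indicator_def)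
  then show ?thesis
    by (simp add: has_bochner_integral_iff integrable_distr_eq integral_distr)
qed

text \<open>Bridge from the gauge integral, where powers are integrated by antiderivatives, to the
  Lebesgue integral; for nonnegative integrands the two agree.\<close>

lemma has_bochner_integral_nonneg_has_integral:
  fixes f :: "'a::euclidean_space \<Rightarrow> real"
  assumes [measurable]: "f \<in> borel_measurable borel" "S \<in> sets borel"
    and nonneg: "\<And>x. x \<in> S \<Longrightarrow> 0 \<le> f x" and I: "(f has_integral I) S"
  shows "has_bochner_integral lborel (\<lambda>x. indicator S x * f x) I"
proof (rule has_bochner_integral_nn_integral)
  show "0 \<le> I"
    using I nonneg by (rule has_integral_nonneg)
  show "(\<integral>\<^sup>+x. ennreal (indicator S x * f x) \<partial>lborel) = ennreal I"
    using nn_integral_has_integral_lebesgue[OF nonneg I] by simp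
qed (auto simp: indicator_def nonneg)

lemma powr_eq_power_mult_powr:
  fixes r :: real
  assumes "r > 0" "n > 0"
  shows "r powr (\<beta> + real n - 1) = r ^ (n - 1) * r powr \<beta>"
proof -
  have "r ^ (n - 1) = r powr (real n - 1)"
    using assms by (simp flip: powr_realpow add: of_nat_diff)
  then show ?thesis
    by (simp add: algebra_simps flip: powr_add)
qed

lemma has_bochner_integral_norm_powr_cball:
  fixes \<beta> :: real
  assumes "\<beta> + real DIM('a) > 0" "\<delta> \<ge> 0"
  shows "has_bochner_integral lborel (\<lambda>y::'a::euclidean_space. indicator {..\<delta>} (norm y) * norm y powr \<beta>)
    (real DIM('a) * unit_ball_vol (real DIM('a)) * (\<delta> powr (\<beta> + real DIM('a)) / (\<beta> + real DIM('a))))"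
proof -
  have "has_bochner_integral lborel (\<lambda>r. indicator {0..\<delta>} r * r powr (\<beta> + real DIM('a) - 1))
      (\<delta> powr (\<beta> + real DIM('a) - 1 + 1) / (\<beta> + real DIM('a) - 1 + 1))"
    using assms by (intro has_bochner_integral_nonneg_has_integral has_integral_powr_from_0) auto
  also have "(\<lambda>r. indicator {0..\<delta>} r * r powr (\<beta> + real DIM('a) - 1)) =
      (\<lambda>r. indicator {0..} r * (r ^ (DIM('a) - 1) * (indicator {..\<delta>} r * r powr \<beta>)))"
  proof
    fix r :: real
    show "indicator {0..\<delta>} r * r powr (\<beta> + real DIM('a) - 1) =
        indicator {0..} r * (r ^ (DIM('a) - 1) * (indicator {..\<delta>} r * r powr \<beta>))"
      \<comment> \<open>At \<open>r = 0\<close> both sides are 0 because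
        \<open>0 powr z = 0\<close>, even in dimension 1, where
        \<open>0 ^ (n - 1) = 1\<close>.\<close>
      by (cases "r > 0") (auto simp: indicator_def powr_eq_power_mult_powr)
  qed
  finally show ?thesis
    by (intro has_bochner_integral_radial) auto
qed

lemma has_bochner_integral_norm_powr_outside:
  fixes \<beta> :: real
  assumes "\<beta> + real DIM('a) < 0" "\<delta> > 0"
  shows "has_bochner_integral lborel (\<lambda>y::'a::euclidean_space. indicator {\<delta>..} (norm y) * norm y powr \<beta>)
    (real DIM('a) * unit_ball_vol (real DIM('a)) * (- (\<delta> powr (\<beta> + real DIM('a))) / (\<beta> + real DIM('a))))"
proof -
  have "has_bochner_integral lborel (\<lambda>r. indicator {\<delta>..} r * r powr (\<beta> + real DIM('a) - 1))
      (- (\<delta> powr (\<beta> + real DIM('a) - 1 + 1)) / (\<beta> + real DIM('a) - 1 + 1))"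
    using assms by (intro has_bochner_integral_nonneg_has_integral has_integral_powr_to_inf) auto
  also have "(\<lambda>r. indicator {\<delta>..} r * r powr (\<beta> + real DIM('a) - 1)) =
      (\<lambda>r. indicator {0..} r * (r ^ (DIM('a) - 1) * (indicator {\<delta>..} r * r powr \<beta>)))"
  proof
    fix r :: real
    show "indicator {\<delta>..} r * r powr (\<beta> + real DIM('a) - 1) =
        indicator {0..} r * (r ^ (DIM('a) - 1) * (indicator {\<delta>..} r * r powr \<beta>))"
      using \<open>\<delta> > 0\<close> by (cases "r > 0") (auto simp: indicator_def powr_eq_power_mult_powr)
  qed
  finally show ?thesis
    by (intro has_bochner_integral_radial) auto
qed

text \<open>Makes the mixed monomials \<open>y_i * y_j\<close> integrate to 0 against radial
  weights. The map is diagonal with entries of modulus 1, so its Jacobian factor is 1.\<close>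

lemma lborel_distr_negate_coordinate:
  fixes i :: "'n::finite"
  shows "distr lborel borel (\<lambda>y::real^'n. \<chi> k. if k = i then - y $ k else y $ k) = lborel"
proof -
  let ?c = "\<lambda>j::real^'n. if j = axis i 1 then - 1 else 1 :: real"
  have "(\<lambda>y::real^'n. 0 + (\<Sum>j\<in>Basis. (?c j * (y \<bullet> j)) *\<^sub>R j)) =
      (\<lambda>y. \<chi> k. if k = i then - y $ k else y $ k)"
  proof
    fix y :: "real^'n"
    let ?T = "\<chi> k. if k = i then - y $ k else y $ k"
    have "?T = (\<Sum>j\<in>Basis. (?T \<bullet> j) *\<^sub>R j)"
      by (rule euclidean_representation[symmetric])
    also have "\<dots> = (\<Sum>j\<in>Basis. (?c j * (y \<bullet> j)) *\<^sub>R j)"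
      by (intro sum.cong refl) (auto simp: Basis_vec_def inner_axis axis_eq_axis)
    finally show "0 + (\<Sum>j\<in>Basis. (?c j * (y \<bullet> j)) *\<^sub>R j) = ?T"
      by simp
  qed
  moreover have "(\<Prod>j\<in>Basis. \<bar>?c j\<bar>) = 1"
    by (intro prod.neutral) auto
  ultimately show ?thesis
    using lborel_affine_euclidean[of ?c "0::real^'n"] by (simp add: density_1 one_ennreal_def[symmetric])
qed

text \<open>Makes all the \<open>y_k^2\<close> have the same integral against a radial weight.
  Lebesgue measure is determined by its values on boxes, and swapping coordinates only permutes the
  side lengths.\<close>

lemma lborel_distr_transpose:
  fixes i j :: "'n::finite"
  shows "distr lborel borel (\<lambda>y::real^'n. \<chi> k. y $ Transposition.transpose i j k) = lborel"
proof (rule lborel_eqI[symmetric])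
  let ?T = "\<lambda>y::real^'n. \<chi> k. y $ Transposition.transpose i j k"
  have [measurable]: "?T \<in> borel_measurable borel"
    by (intro borel_measurable_continuous_onI continuous_on_vec_lambda continuous_intros)
  fix l u :: "real^'n"
  assume *: "\<And>b. b \<in> Basis \<Longrightarrow> l \<bullet> b \<le> u \<bullet> b"
  have le: "l $ k \<le> u $ k" for k
    using *[of "axis k 1"] by (simp add: inner_axis)
  have "?T -` box l u = box (?T l) (?T u)"
    by (auto simp: mem_box_cart) (metis transpose_involutory)+
  then have "emeasure (distr lborel borel ?T) (box l u) = emeasure lborel (box (?T l) (?T u))"
    by (simp add: emeasure_distr)
  also have "\<dots> = (\<Prod>b\<in>Basis. (?T u - ?T l) \<bullet> b)"
    by (rule emeasure_lborel_box) (auto simp: Basis_vec_def inner_axis le)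
  also have "(\<Prod>b\<in>Basis. (?T u - ?T l) \<bullet> b) = (\<Prod>k\<in>UNIV. (?T u - ?T l) $ k)"
    by (simp add: Basis_vec_def UNION_singleton_eq_range prod.reindex inj_on_def axis_eq_axis inner_axis)
  also have "\<dots> = (\<Prod>k\<in>UNIV. (u - l) $ k)"
    by (rule prod.reindex_bij_witness[of _ "Transposition.transpose i j" "Transposition.transpose i j"]) auto
  also have "\<dots> = (\<Prod>b\<in>Basis. (u - l) \<bullet> b)"
    by (simp add: Basis_vec_def UNION_singleton_eq_range prod.reindex inj_on_def axis_eq_axis inner_axis)
  finally show "emeasure (distr lborel borel ?T) (box l u) = ennreal (\<Prod>b\<in>Basis. (u - l) \<bullet> b)" .
qed simp

section \<open>Singular integrals as \<open>s\<close> tends to 1\<close>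

text \<open>The combined exponent is \<open>2 - 2 * s - n\<close>, integrable at the origin exactly
  when \<open>s < 1\<close>. The denominator \<open>2 - 2 * s\<close> is the divergence that
  \<open>frac_const\<close> compensates.\<close>

lemma has_bochner_integral_kernel_cball:
  assumes "s < 1" "\<delta> \<ge> 0"
  shows "has_bochner_integral lborel
    (\<lambda>y::real^'n. indicator {..\<delta>} (norm y) * (norm y)\<^sup>2 / norm y powr (real CARD('n) + 2 * s))
    (real CARD('n) * unit_ball_vol (real CARD('n)) * (\<delta> powr (2 - 2 * s) / (2 - 2 * s)))"
proof -
  have "norm y powr (2 - 2 * s - real CARD('n)) = (norm y)\<^sup>2 / norm y powr (real CARD('n) + 2 * s)"
    for y :: "real^'n"
    \<comment> \<open>At the origin both sides are 0, by \<open>0 powr z = 0\<close> and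
      \<open>z / 0 = 0\<close>.\<close>
    by (cases "y = 0") (simp_all add: powr_diff powr_add field_simps powr_numeral)
  then show ?thesis
    using has_bochner_integral_norm_powr_cball[where 'a="real^'n", of "2 - 2 * s - real CARD('n)" \<delta>] assms
    by simp
qed

lemma has_bochner_integral_kernel_outside:
  assumes "s > 0" "\<delta> > 0"
  shows "has_bochner_integral lborel
    (\<lambda>y::real^'n. indicator {\<delta>..} (norm y) / norm y powr (real CARD('n) + 2 * s))
    (real CARD('n) * unit_ball_vol (real CARD('n)) * (\<delta> powr (- 2 * s) / (2 * s)))"
proof -
  have "norm y powr (- 2 * s - real CARD('n)) = 1 / norm y powr (real CARD('n) + 2 * s)"
    for y :: "real^'n"
    by (cases "y = 0") (simp_all add: powr_diff powr_add powr_minus field_simps)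
  then show ?thesis
    using has_bochner_integral_norm_powr_outside[where 'a="real^'n", of "- 2 * s - real CARD('n)" \<delta>] assms
    by simp
qed

text \<open>Splitting at radius \<delta>: inside, the quadratic bound tames the singularity;
  outside, boundedness suffices because the kernel decays integrably for \<open>s > 0\<close>. Only
  the \<open>E\<close> term blows up as \<open>s\<close> tends to 1.\<close>

lemma
  fixes F :: "real^'n \<Rightarrow> real"
  assumes s: "0 < s" "s < 1" and "\<delta> > 0"
    and F [measurable]: "F \<in> borel_measurable borel"
    and bounded: "\<And>y. \<bar>F y\<bar> \<le> C"
    and near: "\<And>y. norm y \<le> \<delta> \<Longrightarrow> \<bar>F y\<bar> \<le> E * (norm y)\<^sup>2"
  shows integrable_kernel: "integrable lborel (\<lambda>y. F y / norm y powr (real CARD('n) + 2 * s))"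
    and abs_integral_kernel_le: "\<bar>LINT y|lborel. F y / norm y powr (real CARD('n) + 2 * s)\<bar> \<le>
      real CARD('n) * unit_ball_vol (real CARD('n)) *
        (E * (\<delta> powr (2 - 2 * s) / (2 - 2 * s)) + C * (\<delta> powr (- 2 * s) / (2 * s)))"
proof -
  let ?N = "\<lambda>y::real^'n. norm y powr (real CARD('n) + 2 * s)"
  let ?V = "real CARD('n) * unit_ball_vol (real CARD('n))"
  define G where "G y = E * (indicator {..\<delta>} (norm y) * (norm y)\<^sup>2 / ?N y)
    + C * (indicator {\<delta>..} (norm y) / ?N y)" for y
  have G: "has_bochner_integral lborel G (E * (?V * (\<delta> powr (2 - 2 * s) / (2 - 2 * s)))
      + C * (?V * (\<delta> powr (- 2 * s) / (2 * s))))"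
    unfolding G_def using s \<open>\<delta> > 0\<close>
    by (intro has_bochner_integral_add has_bochner_integral_mult_right
        has_bochner_integral_kernel_cball has_bochner_integral_kernel_outside) auto
  \<comment> \<open>Needed on the sphere of radius \<delta>, where both indicators in
    \<open>G\<close> are 1 and the extra term must not be negative.\<close>
  have "C \<ge> 0"
    using bounded[of 0] by linarith
  have le: "\<bar>F y / ?N y\<bar> \<le> G y" for y
  proof (cases "norm y \<le> \<delta>")
    case True
    then have "\<bar>F y / ?N y\<bar> \<le> E * (norm y)\<^sup>2 / ?N y"
      using near[OF True] by (simp add: abs_divide divide_right_mono)
    also have "\<dots> \<le> G y"
      using True \<open>C \<ge> 0\<close> by (simp add: G_def)
    finally show ?thesis .
  next
    case False
    then show ?thesis
      using bounded[of y] by (simp add: G_def abs_divide divide_right_mono)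
  qed
  show int: "integrable lborel (\<lambda>y. F y / ?N y)"
    by (rule Bochner_Integration.integrable_bound[OF G[unfolded has_bochner_integral_iff, THEN conjunct1]])
      (use le in \<open>auto intro: order_trans abs_ge_self\<close>)
  have "\<bar>LINT y|lborel. F y / ?N y\<bar> \<le> (LINT y|lborel. \<bar>F y / ?N y\<bar>)"
    by (rule integral_abs_bound)
  also have "\<dots> \<le> (LINT y|lborel. G y)"
    using integrable_abs[OF int] G le by (intro integral_mono) (simp_all add: has_bochner_integral_iff)
  also have "\<dots> = ?V * (E * (\<delta> powr (2 - 2 * s) / (2 - 2 * s)) + C * (\<delta> powr (- 2 * s) / (2 * s)))"
    using G by (simp add: has_bochner_integral_iff algebra_simps)
  finally show "\<bar>LINT y|lborel. F y / ?N y\<bar> \<le> \<dots>" .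
qed

section \<open>Asymptotics of the normalising constant\<close>

lemma frac_const_eq:
  assumes "s < 1"
  shows "frac_const n s = (1 - s) *
    (s * 2 powr (2 * s) * Gamma ((real n + 2 * s) / 2) / (pi powr (real n / 2) * Gamma (2 - s)))"
proof -
  \<comment> \<open>The functional equation isolates the pole of Gamma at 0; the remaining factor
    \<open>Gamma (2 - s)\<close> is continuous at \<open>s = 1\<close>.\<close>
  have "Gamma (1 - s + 1) = (1 - s) * Gamma (1 - s)"
    using assms by (intro Gamma_plus1) (auto elim!: nonpos_Ints_cases)
  moreover have "Gamma (1 - s) > 0"
    using assms by (intro Gamma_real_pos) auto
  moreover have "1 - s + 1 = 2 - s"
    by simp
  ultimately show ?thesis
    using assms by (simp add: frac_const_def)
qed

lemma frac_const_nonneg: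
  assumes "0 < s" "s < 1"
  shows "frac_const n s \<ge> 0"
  using assms by (auto simp: frac_const_def intro!: divide_nonneg_nonneg mult_nonneg_nonneg Gamma_real_nonneg)

text \<open>At \<open>s = 1\<close> the expression is
  \<open>4 * Gamma (n / 2 + 1) / pi powr (n / 2)\<close>, and the unit ball has volume
  \<open>pi powr (n / 2) / Gamma (n / 2 + 1)\<close>.\<close>

lemma tendsto_frac_const_aux:
  "((\<lambda>s. s * 2 powr (2 * s) * Gamma ((real n + 2 * s) / 2) / (pi powr (real n / 2) * Gamma (2 - s)))
     \<longlongrightarrow> 4 / unit_ball_vol (real n)) (at_left 1)"
proof -
  have "((\<lambda>s. s * 2 powr (2 * s) * Gamma ((real n + 2 * s) / 2) / (pi powr (real n / 2) * Gamma (2 - s)))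
     \<longlongrightarrow> 1 * 2 powr (2 * 1) * Gamma ((real n + 2 * 1) / 2) / (pi powr (real n / 2) * Gamma (2 - 1))) (at_left 1)"
    by (intro tendsto_intros) (auto elim!: nonpos_Ints_cases)
  also have "1 * 2 powr (2 * 1) * Gamma ((real n + 2 * 1) / 2) / (pi powr (real n / 2) * Gamma (2 - 1))
      = 4 / unit_ball_vol (real n)"
    by (simp add: unit_ball_vol_def add_divide_distrib)
  finally show ?thesis .
qed

lemma eventually_at_left_1: "eventually (\<lambda>s::real. s \<in> {0<..<1}) (at_left 1)"
  by (rule eventually_at_left_field[THEN iffD2]) (auto intro!: exI[of _ 0])

lemma tendsto_frac_const_0: "(frac_const n \<longlongrightarrow> 0) (at_left 1)"
proof (rule Lim_transform_eventually)
  have "((\<lambda>s. (1 - s) * (s * 2 powr (2 * s) * Gamma ((real n + 2 * s) / 2) /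
      (pi powr (real n / 2) * Gamma (2 - s)))) \<longlongrightarrow> (1 - 1) * (4 / unit_ball_vol (real n))) (at_left 1)"
    by (intro tendsto_mult tendsto_diff tendsto_const tendsto_ident_at tendsto_frac_const_aux)
  then show "((\<lambda>s. (1 - s) * (s * 2 powr (2 * s) * Gamma ((real n + 2 * s) / 2) /
      (pi powr (real n / 2) * Gamma (2 - s)))) \<longlongrightarrow> 0) (at_left 1)"
    by simp
  show "\<forall>\<^sub>F s in at_left 1. (1 - s) * (s * 2 powr (2 * s) * Gamma ((real n + 2 * s) / 2) /
      (pi powr (real n / 2) * Gamma (2 - s))) = frac_const n s"
    using eventually_at_left_1 by eventually_elim (simp add: frac_const_eq)
qed

lemma tendsto_frac_const_normalized:
  "((\<lambda>s. frac_const n s / 2 * (unit_ball_vol (real n) / (2 - 2 * s))) \<longlongrightarrow> 1) (at_left 1)"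
proof (rule Lim_transform_eventually)
  have "unit_ball_vol (real n) \<noteq> 0"
    using unit_ball_vol_pos[of "real n"] by linarith
  then show "((\<lambda>s. (s * 2 powr (2 * s) * Gamma ((real n + 2 * s) / 2) /
      (pi powr (real n / 2) * Gamma (2 - s))) * (unit_ball_vol (real n) / 4)) \<longlongrightarrow> 1) (at_left 1)"
    using tendsto_mult[OF tendsto_frac_const_aux tendsto_const, of n "unit_ball_vol (real n) / 4"] by simp
  show "\<forall>\<^sub>F s in at_left 1. (s * 2 powr (2 * s) * Gamma ((real n + 2 * s) / 2) /
      (pi powr (real n / 2) * Gamma (2 - s))) * (unit_ball_vol (real n) / 4) =
      frac_const n s / 2 * (unit_ball_vol (real n) / (2 - 2 * s))"
    using eventually_at_left_1
  proof eventually_elim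
    case (elim s)
    define g where "g = s * 2 powr (2 * s) * Gamma ((real n + 2 * s) / 2) / (pi powr (real n / 2) * Gamma (2 - s))"
    have "frac_const n s = (1 - s) * g"
      using elim by (simp add: frac_const_eq g_def)
    moreover have "c * g / 2 * (v / (2 * c)) = g * (v / 4)" if "c \<noteq> 0" for c v
      using that by simp
    from this[of "1 - s" "unit_ball_vol (real n)"] elim
    have "(1 - s) * g / 2 * (unit_ball_vol (real n) / (2 - 2 * s)) = g * (unit_ball_vol (real n) / 4)"
      by (simp add: right_diff_distrib)
    ultimately show ?case
      unfolding g_def[symmetric] by simp
  qed
qed

text \<open>As \<open>s \<rightarrow> 1\<close> the integral over the complement of any ball stays bounded while
  \<^const>\<open>frac_const\<close> tends to zero, so only the second-order part of \<open>F\<close> at the origin matters, and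
  by symmetry only its trace.\<close>

definition singular_mean :: "(real^'n \<Rightarrow> real) \<Rightarrow> real \<Rightarrow> real" where
  "singular_mean F s = frac_const CARD('n) s / 2 *
     (LINT y|lborel. F y / norm y powr (real CARD('n) + 2 * s))"

lemma tendsto_singular_mean_0:
  fixes F :: "real^'n \<Rightarrow> real"
  assumes F [measurable]: "F \<in> borel_measurable borel"
    and bounded: "\<And>y. \<bar>F y\<bar> \<le> C"
    and near: "\<And>e. e > 0 \<Longrightarrow> \<exists>d>0. \<forall>y. norm y < d \<longrightarrow> \<bar>F y\<bar> \<le> e * (norm y)\<^sup>2"
  shows "(singular_mean F \<longlongrightarrow> 0) (at_left 1)"
proof (rule tendstoI)
  fix e :: real
  assume "e > 0"
  let ?n = "real CARD('n)"
  let ?V = "unit_ball_vol ?n"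
  \<comment> \<open>The bound \<open>h\<close> below tends to \<open>n * E\<close>, which this
    choice makes equal to \<open>e / 2\<close>.\<close>
  define E where "E = e / (2 * ?n)"
  have "E > 0" and nE: "?n * E < e"
    using \<open>e > 0\<close> by (simp_all add: E_def)
  obtain d where "d > 0" and d: "\<And>y. norm y < d \<Longrightarrow> \<bar>F y\<bar> \<le> E * (norm y)\<^sup>2"
    using near[OF \<open>E > 0\<close>] by blast
  \<comment> \<open>The cap 1 gives \<open>\<delta> powr (2 - 2 * s) \<le> 1\<close>; halving
    \<open>d\<close> places the closed ball of radius \<delta> inside the open one where the
    estimate holds.\<close>
  define \<delta> where "\<delta> = min 1 (d / 2)"
  have \<delta>: "\<delta> > 0" "\<delta> \<le> 1" "\<delta> < d"
    using \<open>d > 0\<close> by (auto simp: \<delta>_def)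
  define h where "h s = ?n * E * (frac_const CARD('n) s / 2 * (?V / (2 - 2 * s)))
    + frac_const CARD('n) s * (?n * ?V * C * (\<delta> powr (- 2 * s) / (2 * s)) / 2)" for s
  have "(h \<longlongrightarrow> ?n * E * 1 + 0 * (?n * ?V * C * (\<delta> powr (- 2 * 1) / (2 * 1)) / 2)) (at_left 1)"
    unfolding h_def using \<delta>
    by (intro tendsto_add tendsto_mult tendsto_const tendsto_frac_const_normalized tendsto_frac_const_0
        tendsto_divide tendsto_powr tendsto_ident_at) auto
  then have "\<forall>\<^sub>F s in at_left 1. h s < e"
    using nE by (intro order_tendstoD(2)) auto
  then show "\<forall>\<^sub>F s in at_left 1. dist (singular_mean F s) 0 < e"
    using eventually_at_left_1
  proof eventually_elim
    case (elim s)
    have "\<bar>LINT y|lborel. F y / norm y powr (?n + 2 * s)\<bar> \<le>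
        ?n * ?V * (E * (\<delta> powr (2 - 2 * s) / (2 - 2 * s)) + C * (\<delta> powr (- 2 * s) / (2 * s)))"
      using elim \<delta> d by (intro abs_integral_kernel_le bounded) auto
    also have "\<dots> \<le> ?n * ?V * (E * (1 / (2 - 2 * s)) + C * (\<delta> powr (- 2 * s) / (2 * s)))"
      using elim \<delta> \<open>E > 0\<close> powr_mono2[of "2 - 2 * s" \<delta> 1]
      by (intro mult_left_mono add_right_mono divide_right_mono) auto
    finally have "frac_const CARD('n) s / 2 * \<bar>LINT y|lborel. F y / norm y powr (?n + 2 * s)\<bar> \<le>
        frac_const CARD('n) s / 2 * (?n * ?V * (E * (1 / (2 - 2 * s)) + C * (\<delta> powr (- 2 * s) / (2 * s))))"
      using elim frac_const_nonneg[of s "CARD('n)"] by (intro mult_left_mono) auto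
    also have "\<dots> = h s"
      by (simp add: h_def algebra_simps)
    finally show ?case
      using elim frac_const_nonneg[of s "CARD('n)"] by (simp add: singular_mean_def abs_mult)
  qed
qed

text \<open>For distinct indices the integrand is odd under reflection of coordinate
  \<open>i\<close>. The diagonal integrals agree by transposition and add up to the integral of the
  kernel times \<open>(norm y)^2\<close>, so each is one \<open>n\<close>-th of it.\<close>

lemma has_bochner_integral_kernel_coordinates:
  fixes i j :: "'n::finite"
  assumes "s < 1"
  shows "has_bochner_integral lborel
    (\<lambda>y::real^'n. indicator {..1} (norm y) * (y $ i * y $ j) / norm y powr (real CARD('n) + 2 * s))
    (if i = j then unit_ball_vol (real CARD('n)) / (2 - 2 * s) else 0)"
proof -
  let ?n = "real CARD('n)"
  define f where "f i j y = indicator {..1} (norm y) * (y $ i * y $ j) / norm y powr (?n + 2 * s)"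
    for i j and y :: "real^'n"
  have [measurable]: "f i j \<in> borel_measurable borel" for i j
    unfolding f_def by measurable
  note K = has_bochner_integral_kernel_cball[where 'n='n, OF assms, of 1]
  have int: "integrable lborel (f i j)" for i j
  proof (rule Bochner_Integration.integrable_bound)
    show "integrable lborel (\<lambda>y::real^'n. indicator {..1} (norm y) * (norm y)\<^sup>2 / norm y powr (?n + 2 * s))"
      using K by (simp add: has_bochner_integral_iff)
    have "\<bar>y $ i * y $ j\<bar> \<le> (norm y)\<^sup>2" for y :: "real^'n"
      by (simp add: abs_mult power2_eq_square mult_mono component_le_norm_cart)
    then show "AE y in lborel. norm (f i j y) \<le>
        norm (indicator {..1} (norm y) * (norm y)\<^sup>2 / norm y powr (?n + 2 * s))"
      by (auto simp: f_def abs_mult indicator_def intro!: divide_right_mono)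
  qed simp
  have "integral\<^sup>L lborel (f i j) = (if i = j then unit_ball_vol ?n / (2 - 2 * s) else 0)" for i j
  proof (cases "i = j")
    case False
    let ?T = "\<lambda>y::real^'n. \<chi> k. if k = i then - y $ k else y $ k"
    have [measurable]: "?T \<in> borel_measurable borel"
    proof (intro borel_measurable_continuous_onI continuous_on_vec_lambda)
      show "continuous_on UNIV (\<lambda>y::real^'n. if k = i then - y $ k else y $ k)" for k
        by (cases "k = i") (auto intro!: continuous_intros)
    qed
    have "norm (?T y) = norm y" for y
      by (auto simp: norm_vec_def L2_set_def intro!: sum.cong)
    then have "f i j (?T y) = - f i j y" for y
      using False by (simp add: f_def)
    moreover have "integral\<^sup>L lborel (f i j) = (LINT y|lborel. f i j (?T y))"
      by (subst (1) lborel_distr_negate_coordinate[of i, symmetric]) (simp add: integral_distr)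
    ultimately show ?thesis
      using False by simp
  next
    case True
    have eq: "integral\<^sup>L lborel (f k k) = integral\<^sup>L lborel (f i i)" for k
    proof -
      let ?T = "\<lambda>y::real^'n. \<chi> l. y $ Transposition.transpose i k l"
      have [measurable]: "?T \<in> borel_measurable borel"
        by (intro borel_measurable_continuous_onI continuous_on_vec_lambda continuous_intros)
      have "norm (?T y) = norm y" for y
        unfolding norm_vec_def L2_set_def
        by (auto intro!: sum.reindex_bij_witness[of _ "Transposition.transpose i k" "Transposition.transpose i k"])
      then have "f k k (?T y) = f i i y" for y
        by (simp add: f_def)
      moreover have "integral\<^sup>L lborel (f k k) = (LINT y|lborel. f k k (?T y))"
        by (subst (1) lborel_distr_transpose[of i k, symmetric]) (simp add: integral_distr)
      ultimately show ?thesis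
        by simp
    qed
    have "(\<Sum>k\<in>UNIV. f k k y) = indicator {..1} (norm y) * (norm y)\<^sup>2 / norm y powr (?n + 2 * s)" for y
      by (simp add: f_def power2_norm_eq_inner inner_vec_def sum_divide_distrib sum_distrib_left)
    then have "?n * unit_ball_vol ?n * (1 / (2 - 2 * s)) = (LINT y|lborel. (\<Sum>k\<in>UNIV. f k k y))"
      using K by (simp add: has_bochner_integral_iff)
    also have "\<dots> = (\<Sum>k\<in>(UNIV::'n set). integral\<^sup>L lborel (f k k))"
      using int by (intro Bochner_Integration.integral_sum) auto
    also have "\<dots> = ?n * integral\<^sup>L lborel (f i i)"
      by (subst sum.cong[OF refl eq]) simp_all
    finally have "?n * (unit_ball_vol ?n / (2 - 2 * s)) = ?n * integral\<^sup>L lborel (f i i)"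
      by simp
    then have "unit_ball_vol ?n / (2 - 2 * s) = integral\<^sup>L lborel (f i i)"
      by (subst (asm) mult_cancel_left) simp
    then show ?thesis
      using True by simp
  qed
  then show ?thesis
    using int by (simp add: has_bochner_integral_iff f_def[symmetric])
qed

lemma
  fixes F :: "real^'n \<Rightarrow> real" and A :: "'n \<Rightarrow> 'n \<Rightarrow> real"
  assumes F [measurable]: "F \<in> borel_measurable borel"
    and bounded: "\<And>y. \<bar>F y\<bar> \<le> C"
    and near: "\<And>e. e > 0 \<Longrightarrow> \<exists>d>0. \<forall>y. norm y < d \<longrightarrow>
      \<bar>F y - (\<Sum>i\<in>UNIV. \<Sum>j\<in>UNIV. A i j * (y $ i * y $ j))\<bar> \<le> e * (norm y)\<^sup>2"
  shows integrable_kernel_quadratic: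
      "0 < s \<Longrightarrow> s < 1 \<Longrightarrow> integrable lborel (\<lambda>y. F y / norm y powr (real CARD('n) + 2 * s))"
    and tendsto_singular_mean: "(singular_mean F \<longlongrightarrow> (\<Sum>i\<in>UNIV. A i i)) (at_left 1)"
proof -
  let ?n = "real CARD('n)"
  define Q where "Q y = (\<Sum>i\<in>UNIV. \<Sum>j\<in>UNIV. A i j * (y $ i * y $ j))" for y :: "real^'n"
  define M where "M = (\<Sum>i\<in>UNIV. \<Sum>j\<in>UNIV. \<bar>A i j\<bar>)"
  have [measurable]: "Q \<in> borel_measurable borel"
    unfolding Q_def by measurable
  have Q_le: "\<bar>Q y\<bar> \<le> M * (norm y)\<^sup>2" for y
  proof -
    have "\<bar>y $ i * y $ j\<bar> \<le> (norm y)\<^sup>2" for i j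
      by (simp add: abs_mult power2_eq_square mult_mono component_le_norm_cart)
    then have "\<bar>A i j * (y $ i * y $ j)\<bar> \<le> \<bar>A i j\<bar> * (norm y)\<^sup>2" for i j
      by (subst abs_mult) (intro mult_left_mono, auto)
    then show ?thesis
      unfolding Q_def M_def sum_distrib_right
      by (intro order_trans[OF sum_abs] sum_mono) auto
  qed
  \<comment> \<open>\<open>Q\<close> is unbounded, so only its truncation to the unit ball is
    subtracted: \<open>R\<close> stays bounded and is little-o of \<open>(norm y)^2\<close> at the
    origin.\<close>
  define R where "R y = F y - indicator {..1} (norm y) * Q y" for y
  have [measurable]: "R \<in> borel_measurable borel"
    unfolding R_def by measurable
  have "M \<ge> 0"
    unfolding M_def by (intro sum_nonneg) auto
  have "\<bar>indicator {..1} (norm y) * Q y\<bar> \<le> M" for y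
    using Q_le[of y] mult_left_mono[OF power_le_one[of "norm y" 2] \<open>M \<ge> 0\<close>] \<open>M \<ge> 0\<close>
    by (auto simp: indicator_def)
  then have R_bounded: "\<bar>R y\<bar> \<le> C + M" for y
    using bounded[of y] unfolding R_def by (smt (verit) abs_triangle_ineq4)
  have R_near: "\<exists>d>0. \<forall>y. norm y < d \<longrightarrow> \<bar>R y\<bar> \<le> e * (norm y)\<^sup>2" if e: "e > 0" for e
  proof -
    obtain d where "d > 0" and "\<forall>y. norm y < d \<longrightarrow> \<bar>F y - Q y\<bar> \<le> e * (norm y)\<^sup>2"
      using near[OF e] unfolding Q_def by blast
    then show ?thesis
      \<comment> \<open>Within radius 1 the truncation is invisible.\<close>
      by (intro exI[of _ "min d 1"]) (auto simp: R_def)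
  qed
  have R_int: "integrable lborel (\<lambda>y. R y / norm y powr (?n + 2 * s))" if "0 < s" "s < 1" for s
  proof -
    obtain d where "d > 0" and d: "\<forall>y. norm y < d \<longrightarrow> \<bar>R y\<bar> \<le> 1 * (norm y)\<^sup>2"
      using R_near[of 1] by auto
    then show ?thesis
      using that R_bounded by (intro integrable_kernel[of s "d/2" R "C + M" 1]) auto
  qed
  have Q_int: "has_bochner_integral lborel (\<lambda>y. indicator {..1} (norm y) * Q y / norm y powr (?n + 2 * s))
      ((\<Sum>i\<in>UNIV. A i i) * (unit_ball_vol ?n / (2 - 2 * s)))" if "s < 1" for s
  proof -
    have "has_bochner_integral lborel (\<lambda>y::real^'n. \<Sum>i\<in>UNIV. \<Sum>j\<in>UNIV. A i j *
          (indicator {..1} (norm y) * (y $ i * y $ j) / norm y powr (?n + 2 * s)))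
        (\<Sum>i\<in>UNIV. \<Sum>j\<in>UNIV. A i j * (if i = j then unit_ball_vol ?n / (2 - 2 * s) else 0))"
      using that by (intro has_bochner_integral_sum has_bochner_integral_mult_right
          has_bochner_integral_kernel_coordinates)
    moreover have "(\<lambda>y::real^'n. \<Sum>i\<in>UNIV. \<Sum>j\<in>UNIV. A i j *
          (indicator {..1} (norm y) * (y $ i * y $ j) / norm y powr (?n + 2 * s))) =
        (\<lambda>y. indicator {..1} (norm y) * Q y / norm y powr (?n + 2 * s))"
      by (simp add: Q_def sum_distrib_left sum_divide_distrib ac_simps)
    moreover have "(\<Sum>i\<in>UNIV. \<Sum>j\<in>UNIV. A i j * (if i = j then unit_ball_vol ?n / (2 - 2 * s) else 0))
        = (\<Sum>i\<in>UNIV. A i i) * (unit_ball_vol ?n / (2 - 2 * s))"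
      by (simp add: if_distrib[of "\<lambda>x. _ * x"] sum_distrib_right sum_divide_distrib cong: if_cong)
    ultimately show ?thesis
      by simp
  qed
  have split: "F y / norm y powr (?n + 2 * s) = R y / norm y powr (?n + 2 * s)
      + indicator {..1} (norm y) * Q y / norm y powr (?n + 2 * s)" for y s
    by (simp add: R_def diff_divide_distrib)
  show "integrable lborel (\<lambda>y. F y / norm y powr (?n + 2 * s))" if "0 < s" "s < 1" for s
    unfolding split using R_int[OF that] Q_int[OF \<open>s < 1\<close>] by (simp add: has_bochner_integral_iff)
  show "(singular_mean F \<longlongrightarrow> (\<Sum>i\<in>UNIV. A i i)) (at_left 1)"
  proof (rule Lim_transform_eventually)
    show "((\<lambda>s. singular_mean R s + (\<Sum>i\<in>UNIV. A i i) *
        (frac_const CARD('n) s / 2 * (unit_ball_vol ?n / (2 - 2 * s)))) \<longlongrightarrow> (\<Sum>i\<in>UNIV. A i i)) (at_left 1)"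
      using tendsto_add[OF tendsto_singular_mean_0[OF _ R_bounded R_near]
          tendsto_mult[OF tendsto_const tendsto_frac_const_normalized]] by simp
    show "\<forall>\<^sub>F s in at_left 1. singular_mean R s + (\<Sum>i\<in>UNIV. A i i) *
        (frac_const CARD('n) s / 2 * (unit_ball_vol ?n / (2 - 2 * s))) = singular_mean F s"
      using eventually_at_left_1
    proof eventually_elim
      case (elim s)
      then have "(LINT y|lborel. F y / norm y powr (?n + 2 * s)) =
          (LINT y|lborel. R y / norm y powr (?n + 2 * s)) +
          (\<Sum>i\<in>UNIV. A i i) * (unit_ball_vol ?n / (2 - 2 * s))"
        unfolding split using R_int[of s] Q_int[of s] by (simp add: has_bochner_integral_iff)
      then show ?case
        by (simp add: singular_mean_def algebra_simps)
    qed
  qed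
qed

section \<open>Second-order expansions\<close>

text \<open>The chain rule along each coordinate line forces
  \<open>partial_deriv i u x = D (axis i 1)\<close> for the Frechet derivative \<open>D\<close>, and
  linearity then determines \<open>D\<close>.\<close>

lemma has_derivative_grad:
  fixes u :: "real^'n \<Rightarrow> real"
  assumes "u differentiable (at x)"
  shows "(u has_derivative (\<lambda>h. grad u x \<bullet> h)) (at x)"
proof -
  obtain D where D: "(u has_derivative D) (at x)"
    using assms by (auto simp: differentiable_def)
  then interpret D: linear D
    by (rule has_derivative_linear)
  have partial: "partial_deriv i u x = D (axis i 1)" for i
  proof -
    have "((\<lambda>t. u (x + t *\<^sub>R axis i 1)) has_derivative (\<lambda>t. D (t *\<^sub>R axis i 1))) (at 0)"
      by (rule has_derivative_compose[of "\<lambda>t. x + t *\<^sub>R axis i 1"])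
        (auto intro!: derivative_eq_intros D)
    then have "((\<lambda>t. u (x + t *\<^sub>R axis i 1)) has_real_derivative D (axis i 1)) (at 0)"
      by (simp add: has_field_derivative_def D.scale mult_commute_abs)
    then show ?thesis
      unfolding partial_deriv_def by (rule DERIV_imp_deriv)
  qed
  have "D h = grad u x \<bullet> h" for h
  proof -
    have "D h = D (\<Sum>i\<in>UNIV. (h $ i) *\<^sub>R axis i 1)"
      using basis_expansion[of h] by (simp add: scalar_mult_eq_scaleR)
    also have "\<dots> = grad u x \<bullet> h"
      by (simp add: D.sum D.scale inner_vec_def grad_def partial mult.commute)
    finally show ?thesis .
  qed
  then have "D = (\<lambda>h. grad u x \<bullet> h)"
    by auto
  with D show ?thesis
    by simp
qed

lemma grad_approx:
  fixes u :: "real^'n \<Rightarrow> real"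
  assumes "u differentiable (at x)" "e > 0"
  shows "\<exists>d>0. \<forall>y. norm y < d \<longrightarrow> \<bar>u (x + y) - u x - grad u x \<bullet> y\<bar> \<le> e * norm y"
proof -
  obtain d where "d > 0"
    and d: "\<And>z. norm (z - x) < d \<Longrightarrow> norm (u z - u x - grad u x \<bullet> (z - x)) \<le> e * norm (z - x)"
    using has_derivative_grad[OF assms(1)] \<open>e > 0\<close> unfolding has_derivative_at_alt by blast
  then show ?thesis
    using d[of "x + y" for y] by (intro exI[of _ d]) auto
qed

text \<open>Mean value inequality on \<open>[0, 1]\<close> for the symmetric sum along the line
  through \<open>x\<close> in direction \<open>y\<close>, minus \<open>t^2\<close> times the Hessian
  form. Its derivative consists of first-order remainders of the partial derivatives at
  \<open>x\<close>, paired with \<open>y\<close>.\<close>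

lemma second_difference_approx:
  fixes u :: "real^'n \<Rightarrow> real"
  assumes u: "\<And>z. u differentiable (at z)"
    and du: "\<And>i. partial_deriv i u differentiable (at x)"
    and "e > 0"
  shows "\<exists>d>0. \<forall>y. norm y < d \<longrightarrow>
    \<bar>(2 * u x - u (x + y) - u (x - y)) -
      (\<Sum>i\<in>UNIV. \<Sum>j\<in>UNIV. - partial_deriv j (partial_deriv i u) x * (y $ i * y $ j))\<bar>
    \<le> e * (norm y)\<^sup>2"
proof -
  \<comment> \<open>There are \<open>n\<close> coordinates, each contributing two remainders, at
    \<open>t y\<close> and at \<open>- t y\<close>.\<close>
  define e' where "e' = e / (2 * real CARD('n))"
  have "e' > 0"
    using \<open>e > 0\<close> by (simp add: e'_def)
  have "\<forall>i. \<exists>d>0. \<forall>y. norm y < d \<longrightarrow>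
      \<bar>partial_deriv i u (x + y) - partial_deriv i u x - grad (partial_deriv i u) x \<bullet> y\<bar> \<le> e' * norm y"
    using grad_approx[OF du \<open>e' > 0\<close>] by blast
  then obtain \<delta> where \<delta>: "\<And>i. \<delta> i > 0" "\<And>i y. norm y < \<delta> i \<Longrightarrow>
      \<bar>partial_deriv i u (x + y) - partial_deriv i u x - grad (partial_deriv i u) x \<bullet> y\<bar> \<le> e' * norm y"
    by metis
  define d where "d = Min (range \<delta>)"
  have "d > 0" and d: "\<And>i. d \<le> \<delta> i"
    using \<delta>(1) by (auto simp: d_def)
  show ?thesis
  proof (intro exI conjI allI impI)
    show "d > 0" by fact
    fix y :: "real^'n"
    assume y: "norm y < d"
    define q where "q = (\<Sum>i\<in>UNIV. \<Sum>j\<in>UNIV. partial_deriv j (partial_deriv i u) x * (y $ i * y $ j))"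
    define r where "r i z = partial_deriv i u (x + z) - partial_deriv i u x - grad (partial_deriv i u) x \<bullet> z"
      for i z
    \<comment> \<open>Pairing \<open>x + t y\<close> with \<open>x - t y\<close> avoids any appeal to the symmetry of the Hessian.\<close>
    define g where "g t = u (x + t *\<^sub>R y) + u (x - t *\<^sub>R y) - t\<^sup>2 * q" for t
    define g' where "g' t = grad u (x + t *\<^sub>R y) \<bullet> y - grad u (x - t *\<^sub>R y) \<bullet> y - 2 * t * q" for t
    have deriv: "(g has_field_derivative g' t) (at t within {0..1})" for t
    proof -
      have "((\<lambda>t. u (x + t *\<^sub>R y)) has_derivative (\<lambda>h. grad u (x + t *\<^sub>R y) \<bullet> (h *\<^sub>R y))) (at t within {0..1})"
        by (rule has_derivative_compose[OF _ has_derivative_grad[OF u]]) (auto intro!: derivative_eq_intros)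
      moreover have "((\<lambda>t. u (x - t *\<^sub>R y)) has_derivative (\<lambda>h. grad u (x - t *\<^sub>R y) \<bullet> (- (h *\<^sub>R y)))) (at t within {0..1})"
        by (rule has_derivative_compose[OF _ has_derivative_grad[OF u]]) (auto intro!: derivative_eq_intros)
      ultimately show ?thesis
        unfolding g_def g'_def has_field_derivative_def
        by (auto intro!: derivative_eq_intros simp: algebra_simps)
    qed
    have bound: "norm (g' t) \<le> e * (norm y)\<^sup>2" if "t \<in> {0..1}" for t
    proof -
      have "norm (t *\<^sub>R y) \<le> norm y"
        using that by (simp add: mult_left_le_one_le)
      then have r_le: "\<bar>r i (t *\<^sub>R y)\<bar> \<le> e' * norm y" "\<bar>r i (- (t *\<^sub>R y))\<bar> \<le> e' * norm y" for i
        using \<delta>(2)[of "t *\<^sub>R y" i] \<delta>(2)[of "- (t *\<^sub>R y)" i] y d[of i] \<open>e' > 0\<close>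
        unfolding r_def by (smt (verit) mult_left_mono norm_minus_cancel)+
      have "2 * t * q = (\<Sum>i\<in>UNIV. y $ i * (2 * (grad (partial_deriv i u) x \<bullet> (t *\<^sub>R y))))"
        by (simp add: q_def inner_vec_def grad_def sum_distrib_left algebra_simps)
      moreover have "grad u z \<bullet> y = (\<Sum>i\<in>UNIV. y $ i * partial_deriv i u z)" for z
        by (simp add: inner_vec_def grad_def mult.commute)
      \<comment> \<open>The values \<open>partial_deriv i u x\<close> cancel between the two points,
        and \<open>2 * t * q\<close> absorbs the two linear parts.\<close>
      ultimately have "g' t = (\<Sum>i\<in>UNIV. y $ i * (r i (t *\<^sub>R y) - r i (- (t *\<^sub>R y))))"
        unfolding g'_def r_def by (simp add: algebra_simps flip: sum.distrib sum_subtractf)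
      also have "\<bar>\<dots>\<bar> \<le> (\<Sum>i\<in>(UNIV::'n set). norm y * (2 * (e' * norm y)))"
      proof (intro order_trans[OF sum_abs] sum_mono)
        fix i
        have "\<bar>r i (t *\<^sub>R y) - r i (- (t *\<^sub>R y))\<bar> \<le> 2 * (e' * norm y)"
          using r_le[of i] by linarith
        then show "\<bar>y $ i * (r i (t *\<^sub>R y) - r i (- (t *\<^sub>R y)))\<bar> \<le> norm y * (2 * (e' * norm y))"
          unfolding abs_mult by (intro mult_mono component_le_norm_cart) auto
      qed
      also have "\<dots> = e * (norm y)\<^sup>2"
        by (simp add: e'_def power2_eq_square)
      finally show ?thesis
        by simp
    qed
    have "norm (g 1 - g 0) \<le> e * (norm y)\<^sup>2 * norm (1 - 0 :: real)"
      by (rule field_differentiable_bound[OF _ deriv bound]) auto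
    then show "\<bar>(2 * u x - u (x + y) - u (x - y)) -
        (\<Sum>i\<in>UNIV. \<Sum>j\<in>UNIV. - partial_deriv j (partial_deriv i u) x * (y $ i * y $ j))\<bar>
        \<le> e * (norm y)\<^sup>2"
      by (simp add: g_def q_def sum_negf algebra_simps)
  qed
qed

lemma difference_le_norm:
  fixes u :: "real^'n \<Rightarrow> real"
  assumes "u differentiable (at x)"
  shows "\<exists>d>0. \<forall>y. norm y < d \<longrightarrow> \<bar>u (x + y) - u x\<bar> \<le> (norm (grad u x) + 1) * norm y"
proof -
  obtain d where "d > 0" and d: "\<And>y. norm y < d \<Longrightarrow> \<bar>u (x + y) - u x - grad u x \<bullet> y\<bar> \<le> 1 * norm y"
    using grad_approx[OF assms, of 1] by auto
  have "\<bar>u (x + y) - u x\<bar> \<le> (norm (grad u x) + 1) * norm y" if "norm y < d" for y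
    using d[OF that] Cauchy_Schwarz_ineq2[of "grad u x" y] by (simp add: algebra_simps)
  with \<open>d > 0\<close> show ?thesis
    by blast
qed

text \<open>Difference of squares: the increment minus its linear part is little-o of
  \<open>norm y\<close>, and the increment plus its linear part is at most
  \<open>K * norm y\<close>.\<close>

lemma squared_difference_approx:
  fixes u :: "real^'n \<Rightarrow> real"
  assumes u: "u differentiable (at x)" and "e > 0"
  shows "\<exists>d>0. \<forall>y. norm y < d \<longrightarrow>
    \<bar>(u x - u (x + y))\<^sup>2 -
      (\<Sum>i\<in>UNIV. \<Sum>j\<in>UNIV. (partial_deriv i u x * partial_deriv j u x) * (y $ i * y $ j))\<bar>
    \<le> e * (norm y)\<^sup>2"
proof -
  \<comment> \<open>One \<open>norm (grad u x) + 1\<close> bounds the increment of \<open>u\<close>,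
    and one more \<open>norm (grad u x)\<close> comes from Cauchy-Schwarz.\<close>
  define K where "K = 2 * norm (grad u x) + 1"
  have "K > 0"
    by (simp add: K_def add_nonneg_pos)
  obtain d1 where "d1 > 0" and d1: "\<And>y. norm y < d1 \<Longrightarrow> \<bar>u (x + y) - u x\<bar> \<le> (norm (grad u x) + 1) * norm y"
    using difference_le_norm[OF u] by blast
  obtain d2 where "d2 > 0" and d2: "\<And>y. norm y < d2 \<Longrightarrow> \<bar>u (x + y) - u x - grad u x \<bullet> y\<bar> \<le> (e / K) * norm y"
    using grad_approx[OF u, of "e / K"] \<open>e > 0\<close> \<open>K > 0\<close> by auto
  show ?thesis
  proof (intro exI conjI allI impI)
    show "min d1 d2 > 0"
      using \<open>d1 > 0\<close> \<open>d2 > 0\<close> by simp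
    fix y :: "real^'n"
    assume y: "norm y < min d1 d2"
    have sum: "(\<Sum>i\<in>UNIV. \<Sum>j\<in>UNIV. (partial_deriv i u x * partial_deriv j u x) * (y $ i * y $ j)) = (grad u x \<bullet> y)\<^sup>2"
      by (simp add: inner_vec_def grad_def power2_eq_square sum_product ac_simps)
    have "\<bar>u (x + y) - u x + grad u x \<bullet> y\<bar> \<le> K * norm y"
      using d1[of y] y Cauchy_Schwarz_ineq2[of "grad u x" y] by (simp add: K_def algebra_simps)
    then have "\<bar>u (x + y) - u x - grad u x \<bullet> y\<bar> * \<bar>u (x + y) - u x + grad u x \<bullet> y\<bar>
        \<le> (e / K * norm y) * (K * norm y)"
      using d2[of y] y by (intro mult_mono) (auto intro: order_trans[OF abs_ge_zero])
    also have "\<dots> = e * (norm y)\<^sup>2"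
      using \<open>K > 0\<close> by (simp add: power2_eq_square)
    also have "\<bar>u (x + y) - u x - grad u x \<bullet> y\<bar> * \<bar>u (x + y) - u x + grad u x \<bullet> y\<bar> =
        \<bar>(u x - u (x + y))\<^sup>2 - (grad u x \<bullet> y)\<^sup>2\<bar>"
      by (simp add: power2_eq_square algebra_simps flip: abs_mult)
    finally show "\<bar>(u x - u (x + y))\<^sup>2 -
        (\<Sum>i\<in>UNIV. \<Sum>j\<in>UNIV. (partial_deriv i u x * partial_deriv j u x) * (y $ i * y $ j))\<bar>
        \<le> e * (norm y)\<^sup>2"
      unfolding sum .
  qed
qed

text \<open>Peano form, valid also at endpoints belonging to \<open>U\<close>: the mean value
  inequality is applied along the segment from \<open>a\<close> to \<open>b\<close>, which an
  interval contains.\<close>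

lemma taylor2_within:
  fixes \<phi> \<phi>' :: "real \<Rightarrow> real"
  assumes U: "is_interval U" "a \<in> U"
    and \<phi>: "\<And>t. t \<in> U \<Longrightarrow> (\<phi> has_field_derivative \<phi>' t) (at t within U)"
    and \<phi>': "(\<phi>' has_field_derivative c) (at a within U)"
    and "e > 0"
  shows "\<exists>d>0. \<forall>b\<in>U. \<bar>b - a\<bar> < d \<longrightarrow>
    \<bar>\<phi> b - \<phi> a - \<phi>' a * (b - a) - c / 2 * (b - a)\<^sup>2\<bar> \<le> e * (b - a)\<^sup>2"
proof -
  obtain d where "d > 0"
    and d: "\<And>t. t \<in> U \<Longrightarrow> \<bar>t - a\<bar> < d \<Longrightarrow> \<bar>\<phi>' t - \<phi>' a - c * (t - a)\<bar> \<le> e * \<bar>t - a\<bar>"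
    using \<phi>' \<open>e > 0\<close> unfolding has_field_derivative_def has_derivative_within_alt real_norm_def by blast
  have "\<bar>\<phi> b - \<phi> a - \<phi>' a * (b - a) - c / 2 * (b - a)\<^sup>2\<bar> \<le> e * (b - a)\<^sup>2"
    if "b \<in> U" "\<bar>b - a\<bar> < d" for b
  proof -
    let ?S = "closed_segment a b"
    have "?S \<subseteq> U"
      using U \<open>b \<in> U\<close> by (simp add: closed_segment_subset is_interval_convex)
    \<comment> \<open>The derivative of \<open>T\<close> is the first-order remainder of
      \<open>\<phi>'\<close> at \<open>a\<close>, hence at most \<open>e * \<bar>b - a\<bar>\<close>
      on the segment; integrating it supplies the second factor
      \<open>\<bar>b - a\<bar>\<close>.\<close>
    define T where "T t = \<phi> t - \<phi>' a * (t - a) - c / 2 * (t - a)\<^sup>2" for t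
    have near: "\<bar>t - a\<bar> \<le> \<bar>b - a\<bar>" if "t \<in> ?S" for t
      using that by (auto simp: closed_segment_eq_real_ivl split: if_splits)
    have "norm (T b - T a) \<le> (e * \<bar>b - a\<bar>) * norm (b - a)"
    proof (rule field_differentiable_bound)
      fix t
      assume t: "t \<in> ?S"
      have "(\<phi> has_field_derivative \<phi>' t) (at t within ?S)"
        using \<phi>[of t] t \<open>?S \<subseteq> U\<close> by (blast intro: DERIV_subset)
      then show "(T has_field_derivative \<phi>' t - \<phi>' a - c * (t - a)) (at t within ?S)"
        unfolding T_def by (auto intro!: derivative_eq_intros simp: field_simps)
      show "norm (\<phi>' t - \<phi>' a - c * (t - a)) \<le> e * \<bar>b - a\<bar>"
        using d[of t] near[OF t] t \<open>?S \<subseteq> U\<close> that(2) mult_left_mono[OF near[OF t], of e] \<open>e > 0\<close>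
        unfolding real_norm_def by (meson less_imp_le order_le_less_trans order_trans subsetD)
    qed auto
    then show ?thesis
      by (simp add: T_def power2_eq_square algebra_simps)
  qed
  with \<open>d > 0\<close> show ?thesis
    by blast
qed

text \<open>\<open>S\<close> may accumulate at an endpoint missing from \<open>U\<close>, so
  continuity of \<phi> gives no bound. A Lipschitz derivative is bounded on segments of bounded
  length, and this bounds the increments of \<phi>.\<close>

lemma bounded_image_of_lipschitz_derivative:
  fixes \<phi> \<phi>' :: "real \<Rightarrow> real"
  assumes U: "is_interval U"
    and \<phi>: "\<And>t. t \<in> U \<Longrightarrow> (\<phi> has_field_derivative \<phi>' t) (at t within U)"
    and L: "L-lipschitz_on U \<phi>'"
    and S: "bounded S" "S \<subseteq> U"
  shows "bounded (\<phi> ` S)"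
proof (cases "S = {}")
  case False
  then obtain a where "a \<in> S"
    by blast
  then have "a \<in> U"
    using S by blast
  obtain M where M: "\<And>b. b \<in> S \<Longrightarrow> \<bar>b - a\<bar> \<le> M"
    using S(1) bounded_any_center[of S a] by (auto simp: dist_real_def abs_minus_commute)
  \<comment> \<open>Bounds \<open>\<phi>'\<close> on every segment from \<open>a\<close> to a point
    of \<open>S\<close>, whose length is at most \<open>M\<close>.\<close>
  define B where "B = \<bar>\<phi>' a\<bar> + L * M"
  have "L \<ge> 0"
    using L by (rule lipschitz_on_nonneg)
  have "\<bar>\<phi> b - \<phi> a\<bar> \<le> B * M" if "b \<in> S" for b
  proof -
    let ?T = "closed_segment a b"
    have T: "?T \<subseteq> U"
      using U \<open>a \<in> U\<close> \<open>b \<in> S\<close> S by (intro closed_segment_subset) (auto simp: is_interval_convex)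
    have "norm (\<phi> b - \<phi> a) \<le> B * norm (b - a)"
    proof (rule field_differentiable_bound)
      fix t
      assume t: "t \<in> ?T"
      show "(\<phi> has_field_derivative \<phi>' t) (at t within ?T)"
        using \<phi>[of t] t T by (blast intro: DERIV_subset)
      have "\<bar>t - a\<bar> \<le> M"
        using t M[OF that] by (auto simp: closed_segment_eq_real_ivl split: if_splits)
      then have "L * \<bar>t - a\<bar> \<le> L * M"
        using \<open>L \<ge> 0\<close> by (rule mult_left_mono)
      moreover have "\<bar>\<phi>' t - \<phi>' a\<bar> \<le> L * \<bar>t - a\<bar>"
        using lipschitz_onD[OF L, of t a] t T \<open>a \<in> U\<close> by (auto simp: dist_real_def)
      ultimately show "norm (\<phi>' t) \<le> B"
        by (simp add: B_def)
    qed auto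
    also have "\<dots> \<le> B * M"
      using M[OF that] M[OF \<open>a \<in> S\<close>] \<open>L \<ge> 0\<close> by (intro mult_left_mono) (auto simp: B_def)
    finally show ?thesis
      by simp
  qed
  then show ?thesis
    unfolding bounded_any_center[of _ "\<phi> a"] by (auto simp: dist_real_def abs_minus_commute)
qed simp

text \<open>Used with \<open>c = 1\<close> to move the centre \<open>x\<close> to the origin and
  with \<open>c = - 1\<close> to reflect as well.\<close>

lemma lborel_integral_affine_isometry:
  fixes f :: "'a::euclidean_space \<Rightarrow> real"
  assumes [measurable]: "f \<in> borel_measurable borel" and "\<bar>c\<bar> = 1"
  shows "integrable lborel (\<lambda>y. f (x + c *\<^sub>R y)) \<longleftrightarrow> integrable lborel f"
    and "(LINT y|lborel. f (x + c *\<^sub>R y)) = (LINT y|lborel. f y)"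
proof -
  have *: "lborel = distr lborel borel (\<lambda>y::'a. x + c *\<^sub>R y)"
    using lborel_affine[of c x] assms(2) by (auto simp: density_1)
  show "integrable lborel (\<lambda>y. f (x + c *\<^sub>R y)) \<longleftrightarrow> integrable lborel f"
    by (subst (2) *) (simp add: integrable_distr_eq)
  show "(LINT y|lborel. f (x + c *\<^sub>R y)) = (LINT y|lborel. f y)"
    by (subst (2) *) (simp add: integral_distr)
qed

section \<open>The chain rule\<close>

lemma C1_on_has_derivative:
  assumes "C1_on U f" "t \<in> U"
  shows "(f has_field_derivative deriv_within U f t) (at t within U)"
  using assms vector_derivative_works[of f "at t within U"]
  unfolding C1_on_def differentiable_on_def deriv_within_def has_real_derivative_iff_has_vector_derivative
  by blast

text \<open>Derivatives within \<open>U\<close> are unique only at limit points of \<open>U\<close>.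
  A point of an interval is one unless the interval is that single point.\<close>

lemma deriv_within_eqI:
  assumes "is_interval U" "t \<in> U" "U \<noteq> {t}"
    and "(f has_field_derivative D) (at t within U)"
  shows "deriv_within U f t = D"
proof -
  have "t islimpt U"
    using assms connected_imp_perfect[of U t] is_interval_connected_1[of U]
    by (metis singletonD)
  then show ?thesis
    unfolding deriv_within_def using assms(4)
    by (intro vector_derivative_within)
      (simp_all add: trivial_limit_within has_real_derivative_iff_has_vector_derivative)
qed

lemma schwartz_space_bounded:
  assumes "u \<in> schwartz_space"
  shows "bounded (range u)"
proof -
  have "bounded (range (\<lambda>x. (\<Prod>i\<in>UNIV. (x $ i) ^ m i) * iter_partial js u x))" for m js
    using assms by (simp add: schwartz_space_def)
  from this[of "\<lambda>_. 0" "[]"] show ?thesis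
    by (simp add: iter_partial_def)
qed

lemma schwartz_space_differentiable:
  assumes "u \<in> schwartz_space"
  shows "u differentiable (at z)" "partial_deriv i u differentiable (at z)"
proof -
  have "iter_partial js u differentiable (at z)" for js
    using assms by (auto simp: schwartz_space_def smooth_def differentiable_on_def)
  from this[of "[]"] this[of "[i]"] show "u differentiable (at z)" "partial_deriv i u differentiable (at z)"
    by (simp_all add: iter_partial_def)
qed

locale chain_rule =
  fixes U :: "real set" and \<phi> :: "real \<Rightarrow> real" and u :: "real ^ 'n::finite \<Rightarrow> real"
  assumes U: "is_interval U"
    and C11: "C11_on U \<phi>"
    and C2: "C2_on U \<phi>"
    and u: "u \<in> schwartz_space"
    and range_u: "range u \<subseteq> U"
begin

lemma u_in_U [simp]: "u x \<in> U"
  using range_u by blast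

lemma continuous_u: "continuous_on S u"
  using schwartz_space_differentiable(1)[OF u]
  by (simp add: continuous_at_imp_continuous_on differentiable_imp_continuous_within)

lemma continuous_on_comp:
  assumes "continuous_on U f"
  shows "continuous_on UNIV (\<lambda>y. f (u (x + c *\<^sub>R y)))"
  by (rule continuous_on_compose2[OF assms])
    (auto intro!: continuous_on_compose2[OF continuous_u[of UNIV]] continuous_intros)

lemma \<phi>_deriv: "t \<in> U \<Longrightarrow> (\<phi> has_field_derivative deriv_within U \<phi> t) (at t within U)"
  using C2 by (simp add: C2_on_def C1_on_has_derivative)

lemma \<phi>'_deriv:
  "t \<in> U \<Longrightarrow> (deriv_within U \<phi> has_field_derivative deriv_within U (deriv_within U \<phi>) t) (at t within U)"
  using C2 by (simp add: C2_on_def C1_on_has_derivative)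

section \<open>The Taylor remainder of \<phi> along the values of \<open>u\<close>\<close>

definition taylor_remainder :: "real \<Rightarrow> real \<Rightarrow> real" where
  "taylor_remainder a b = \<phi> b - \<phi> a - deriv_within U \<phi> a * (b - a)
     - deriv_within U (deriv_within U \<phi>) a / 2 * (b - a)\<^sup>2"

lemma continuous_taylor_remainder: "continuous_on U (taylor_remainder a)"
proof -
  have "continuous_on U \<phi>"
    using \<phi>_deriv by (blast intro: DERIV_continuous_on)
  then show ?thesis
    unfolding taylor_remainder_def[abs_def] by (intro continuous_intros)
qed

lemma taylor_remainder_bounded: "\<exists>C. \<forall>y. \<bar>taylor_remainder a (u y)\<bar> \<le> C"
proof -
  obtain L where "L-lipschitz_on U (deriv_within U \<phi>)"
    using C11 by (auto simp: C11_on_def)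
  then have "bounded (\<phi> ` range u)"
    using U \<phi>_deriv range_u schwartz_space_bounded[OF u]
    by (intro bounded_image_of_lipschitz_derivative) auto
  then obtain B where B: "\<And>y. \<bar>\<phi> (u y)\<bar> \<le> B"
    by (auto simp: bounded_iff)
  obtain M where M: "\<And>y. \<bar>u y - a\<bar> \<le> M"
    using schwartz_space_bounded[OF u] bounded_any_center[of "range u" a]
    by (auto simp: dist_real_def abs_minus_commute)
  have "\<bar>taylor_remainder a (u y)\<bar> \<le>
      B + \<bar>\<phi> a\<bar> + \<bar>deriv_within U \<phi> a\<bar> * M + \<bar>deriv_within U (deriv_within U \<phi>) a / 2\<bar> * M\<^sup>2" for y
  proof -
    have "\<bar>deriv_within U \<phi> a * (u y - a)\<bar> \<le> \<bar>deriv_within U \<phi> a\<bar> * M"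
      unfolding abs_mult by (intro mult_left_mono M) auto
    moreover have "(u y - a)\<^sup>2 \<le> M\<^sup>2"
      using M[of y] by (simp add: abs_le_square_iff[symmetric])
    then have "\<bar>deriv_within U (deriv_within U \<phi>) a / 2 * (u y - a)\<^sup>2\<bar>
        \<le> \<bar>deriv_within U (deriv_within U \<phi>) a / 2\<bar> * M\<^sup>2"
      unfolding abs_mult[of _ "(u y - a)\<^sup>2"] by (intro mult_left_mono) auto
    ultimately show ?thesis
      using B[of y] unfolding taylor_remainder_def by linarith
  qed
  then show ?thesis
    by blast
qed

text \<open>The Peano estimate in the values of \<open>u\<close> becomes one in \<open>y\<close>
  through \<open>\<bar>u (x + y) - u x\<bar> \<le> K * norm y\<close>; this explains the tolerance
  \<open>e / K^2\<close> and the radius \<open>d2 / K\<close>.\<close>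

lemma taylor_remainder_near:
  assumes "e > 0"
  shows "\<exists>d>0. \<forall>y. norm y < d \<longrightarrow> \<bar>taylor_remainder (u x) (u (x + y))\<bar> \<le> e * (norm y)\<^sup>2"
proof -
  define K where "K = norm (grad u x) + 1"
  have "K > 0"
    by (simp add: K_def add_nonneg_pos)
  obtain d1 where "d1 > 0" and d1: "\<And>y. norm y < d1 \<Longrightarrow> \<bar>u (x + y) - u x\<bar> \<le> K * norm y"
    using difference_le_norm[OF schwartz_space_differentiable(1)[OF u]] unfolding K_def by blast
  obtain d2 where "d2 > 0"
    and d2: "\<And>b. b \<in> U \<Longrightarrow> \<bar>b - u x\<bar> < d2 \<Longrightarrow> \<bar>taylor_remainder (u x) b\<bar> \<le> e / K\<^sup>2 * (b - u x)\<^sup>2"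
    using taylor2_within[OF U u_in_U[of x] \<phi>_deriv \<phi>'_deriv[OF u_in_U], of "e / K\<^sup>2"] \<open>e > 0\<close> \<open>K > 0\<close>
    unfolding taylor_remainder_def by (auto simp del: times_divide_eq_left times_divide_eq_right)
  have "\<bar>taylor_remainder (u x) (u (x + y))\<bar> \<le> e * (norm y)\<^sup>2" if y: "norm y < min d1 (d2 / K)" for y
  proof -
    have le: "\<bar>u (x + y) - u x\<bar> \<le> K * norm y"
      using d1 y by simp
    also have "\<dots> < d2"
      using y \<open>K > 0\<close> by (simp add: field_simps)
    finally have "\<bar>taylor_remainder (u x) (u (x + y))\<bar> \<le> e / K\<^sup>2 * (u (x + y) - u x)\<^sup>2"
      by (intro d2) simp_all
    also have "\<dots> \<le> e / K\<^sup>2 * (K * norm y)\<^sup>2"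
      using le \<open>e > 0\<close> power_mono[OF le, of 2] by (intro mult_left_mono) auto
    also have "\<dots> = e * (norm y)\<^sup>2"
      using \<open>K > 0\<close> by (simp add: power_mult_distrib)
    finally show ?thesis .
  qed
  then show ?thesis
    using \<open>d1 > 0\<close> \<open>d2 > 0\<close> \<open>K > 0\<close> by (intro exI[of _ "min d1 (d2 / K)"]) auto
qed

lemma taylor_remainder_quadratic:
  assumes quad: "\<forall>t\<in>U. \<phi> t = a * t\<^sup>2 + b * t + c" and t: "t \<in> U" "t' \<in> U"
  shows "taylor_remainder t t' = 0"
proof (cases "U = {t}")
  case True \<comment> \<open>here \<^const>\<open>deriv_within\<close> is an arbitrary number\<close>
  with t have "t' = t"
    by blast
  then show ?thesis
    by (simp add: taylor_remainder_def)
next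
  case False
  have nontrivial: "U \<noteq> {r}" if "r \<in> U" for r
    using False t by auto
  \<comment> \<open>Required on all of \<open>U\<close>, not only at \<open>t\<close>, because this
    function is differentiated next.\<close>
  have d1: "deriv_within U \<phi> r = 2 * a * r + b" if "r \<in> U" for r
  proof (rule deriv_within_eqI[OF U that nontrivial[OF that]])
    have "((\<lambda>t. a * t\<^sup>2 + b * t + c) has_field_derivative 2 * a * r + b) (at r within U)"
      by (auto intro!: derivative_eq_intros)
    \<comment> \<open>The formula for \<phi> is known only on \<open>U\<close>, so the derivative is
      transferred by equality eventually within \<open>U\<close>.\<close>
    then show "(\<phi> has_field_derivative 2 * a * r + b) (at r within U)"
      using quad that by (subst has_field_derivative_cong_eventually[where g="\<lambda>t. a * t\<^sup>2 + b * t + c"])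
        (auto simp: eventually_at_filter)
  qed
  have d2: "deriv_within U (deriv_within U \<phi>) t = 2 * a"
  proof (rule deriv_within_eqI[OF U t(1) False])
    have "((\<lambda>t. 2 * a * t + b) has_field_derivative 2 * a) (at t within U)"
      by (auto intro!: derivative_eq_intros)
    then show "(deriv_within U \<phi> has_field_derivative 2 * a) (at t within U)"
      using d1 t by (subst has_field_derivative_cong_eventually[where g="\<lambda>t. 2 * a * t + b"])
        (auto simp: eventually_at_filter)
  qed
  show ?thesis
    using quad t by (simp add: taylor_remainder_def d1 d2 power2_eq_square algebra_simps)
qed

section \<open>The three numerators over the kernel and their limits\<close>

definition second_difference :: "real^'n \<Rightarrow> real^'n \<Rightarrow> real" where
  "second_difference x y = 2 * u x - u (x + y) - u (x - y)"

definition squared_difference :: "real^'n \<Rightarrow> real^'n \<Rightarrow> real" where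
  "squared_difference x y = (u x - u (x + y))\<^sup>2"

text \<open>Up to sign, the numerator of the singular integral that represents
  \<open>chain_remainder\<close>.\<close>

definition symmetric_remainder :: "real^'n \<Rightarrow> real^'n \<Rightarrow> real" where
  "symmetric_remainder x y = taylor_remainder (u x) (u (x + y)) + taylor_remainder (u x) (u (x - y))"

lemma borel_measurable_u_comp:
  assumes "continuous_on U f"
  shows "(\<lambda>y. f (u (x + y))) \<in> borel_measurable borel" "(\<lambda>y. f (u (x - y))) \<in> borel_measurable borel"
  using continuous_on_comp[OF assms, of x 1] continuous_on_comp[OF assms, of x "-1"]
  by (simp_all add: borel_measurable_continuous_onI)

lemmas [measurable] = borel_measurable_u_comp[OF continuous_on_id]

lemma u_difference_bounded: "\<exists>M. \<forall>y. \<bar>u x - u y\<bar> \<le> M"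
  using schwartz_space_bounded[OF u] bounded_any_center[of "range u" "u x"] by (auto simp: dist_real_def)

text \<open>The matrix is minus the Hessian of \<open>u\<close> at \<open>x\<close>, whose trace is
  \<open>- laplacian u x\<close>.\<close>

lemma
  shows integrable_second_difference: "0 < s \<Longrightarrow> s < 1 \<Longrightarrow>
      integrable lborel (\<lambda>y. second_difference x y / norm y powr (real CARD('n) + 2 * s))"
    and tendsto_second_difference: "(singular_mean (second_difference x) \<longlongrightarrow> - laplacian u x) (at_left 1)"
proof -
  obtain M where M: "\<And>y. \<bar>u x - u y\<bar> \<le> M"
    using u_difference_bounded by blast
  have bound: "\<bar>second_difference x y\<bar> \<le> 2 * M" for y
    using M[of "x + y"] M[of "x - y"] unfolding second_difference_def by linarith
  have meas: "second_difference x \<in> borel_measurable borel"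
    unfolding second_difference_def[abs_def] by measurable
  note near = second_difference_approx[OF schwartz_space_differentiable[OF u], of _ x,
      folded second_difference_def]
  show "integrable lborel (\<lambda>y. second_difference x y / norm y powr (real CARD('n) + 2 * s))"
    if "0 < s" "s < 1" for s
    using integrable_kernel_quadratic[OF meas bound near that] by simp
  show "(singular_mean (second_difference x) \<longlongrightarrow> - laplacian u x) (at_left 1)"
    using tendsto_singular_mean[OF meas bound near] by (simp add: laplacian_def sum_negf)
qed

text \<open>The matrix is the outer product of the gradient with itself, whose trace is its squared
  norm.\<close>

lemma
  shows integrable_squared_difference: "0 < s \<Longrightarrow> s < 1 \<Longrightarrow>
      integrable lborel (\<lambda>y. squared_difference x y / norm y powr (real CARD('n) + 2 * s))"
    and tendsto_squared_difference: "(singular_mean (squared_difference x) \<longlongrightarrow> (norm (grad u x))\<^sup>2) (at_left 1)"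
proof -
  obtain M where M: "\<And>y. \<bar>u x - u y\<bar> \<le> M"
    using u_difference_bounded by blast
  have bound: "\<bar>squared_difference x y\<bar> \<le> M\<^sup>2" for y
    using power_mono[OF M[of "x + y"] abs_ge_zero, of 2] by (simp add: squared_difference_def)
  have meas: "squared_difference x \<in> borel_measurable borel"
    unfolding squared_difference_def[abs_def] by measurable
  note near = squared_difference_approx[OF schwartz_space_differentiable(1)[OF u], of _ x,
      folded squared_difference_def]
  show "integrable lborel (\<lambda>y. squared_difference x y / norm y powr (real CARD('n) + 2 * s))"
    if "0 < s" "s < 1" for s
    using integrable_kernel_quadratic[OF meas bound near that] by simp
  show "(singular_mean (squared_difference x) \<longlongrightarrow> (norm (grad u x))\<^sup>2) (at_left 1)"
    using tendsto_singular_mean[OF meas bound near]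
    by (simp add: power2_norm_eq_inner inner_vec_def grad_def)
qed

lemma
  shows integrable_symmetric_remainder: "0 < s \<Longrightarrow> s < 1 \<Longrightarrow>
      integrable lborel (\<lambda>y. symmetric_remainder x y / norm y powr (real CARD('n) + 2 * s))"
    and tendsto_symmetric_remainder: "(singular_mean (symmetric_remainder x) \<longlongrightarrow> 0) (at_left 1)"
proof -
  obtain C where C: "\<And>y. \<bar>taylor_remainder (u x) (u y)\<bar> \<le> C"
    using taylor_remainder_bounded by blast
  have bound: "\<bar>symmetric_remainder x y\<bar> \<le> 2 * C" for y
    using C[of "x + y"] C[of "x - y"] unfolding symmetric_remainder_def by linarith
  have meas: "symmetric_remainder x \<in> borel_measurable borel"
    unfolding symmetric_remainder_def[abs_def]
    by (intro borel_measurable_add borel_measurable_u_comp continuous_taylor_remainder)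
  have near: "\<exists>d>0. \<forall>y. norm y < d \<longrightarrow>
      \<bar>symmetric_remainder x y - (\<Sum>i\<in>UNIV. \<Sum>j\<in>UNIV. 0 * (y $ i * y $ j))\<bar> \<le> e * (norm y)\<^sup>2"
    if e: "e > 0" for e
  proof -
    \<comment> \<open>Half of \<open>e\<close> for each of the points \<open>x + y\<close> and
      \<open>x - y\<close>; the second is the same estimate at \<open>- y\<close>.\<close>
    obtain d where "d > 0"
      and d: "\<And>y. norm y < d \<Longrightarrow> \<bar>taylor_remainder (u x) (u (x + y))\<bar> \<le> e / 2 * (norm y)\<^sup>2"
      using taylor_remainder_near[of "e / 2" x] e by auto
    have "\<bar>symmetric_remainder x y\<bar> \<le> e * (norm y)\<^sup>2" if "norm y < d" for y
      using d[of y] d[of "- y"] that unfolding symmetric_remainder_def by simp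
    with \<open>d > 0\<close> show ?thesis
      by auto
  qed
  show "integrable lborel (\<lambda>y. symmetric_remainder x y / norm y powr (real CARD('n) + 2 * s))"
    if "0 < s" "s < 1" for s
    using integrable_kernel_quadratic[OF meas bound near that] by simp
  show "(singular_mean (symmetric_remainder x) \<longlongrightarrow> 0) (at_left 1)"
    using tendsto_singular_mean[OF meas bound near] by simp
qed

section \<open>From singular means to the nonlocal operators\<close>

lemma integrable_frac_laplacian_integrand_u:
  assumes "0 < s" "s < 1"
  shows "integrable lborel (frac_laplacian_integrand s u x)"
  using integrable_second_difference[OF assms, of x]
  by (simp add: frac_laplacian_integrand_def[abs_def] second_difference_def)

lemma frac_laplacian_u: "frac_laplacian s u x = singular_mean (second_difference x) s"
  by (simp add: frac_laplacian_def frac_laplacian_integrand_def singular_mean_def second_difference_def)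

text \<open>Substituting \<open>x + c *\<^sub>R y\<close> preserves Lebesgue measure and the kernel.
  The case \<open>c = - 1\<close> is needed because the fractional Laplacian also evaluates at
  \<open>x - y\<close>.\<close>

lemma carre_du_champ_reflect:
  assumes "\<bar>c\<bar> = 1"
  shows "integrable lborel (\<lambda>y. squared_difference x (c *\<^sub>R y) / norm y powr (real CARD('n) + 2 * s)) \<longleftrightarrow>
      integrable lborel (carre_du_champ_integrand s u x)"
    and "(LINT y|lborel. squared_difference x (c *\<^sub>R y) / norm y powr (real CARD('n) + 2 * s)) =
      (LINT y|lborel. carre_du_champ_integrand s u x y)"
proof -
  have [measurable]: "u \<in> borel_measurable borel"
    using continuous_u by (rule borel_measurable_continuous_onI)
  have "carre_du_champ_integrand s u x \<in> borel_measurable borel"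
    unfolding carre_du_champ_integrand_def[abs_def] by measurable
  from lborel_integral_affine_isometry[OF this assms, of x] assms
  show "integrable lborel (\<lambda>y. squared_difference x (c *\<^sub>R y) / norm y powr (real CARD('n) + 2 * s)) \<longleftrightarrow>
      integrable lborel (carre_du_champ_integrand s u x)"
    and "(LINT y|lborel. squared_difference x (c *\<^sub>R y) / norm y powr (real CARD('n) + 2 * s)) =
      (LINT y|lborel. carre_du_champ_integrand s u x y)"
    by (simp_all add: carre_du_champ_integrand_def[abs_def] squared_difference_def)
qed

lemma carre_du_champ_u: "carre_du_champ s u x = singular_mean (squared_difference x) s"
  using carre_du_champ_reflect(2)[of 1 x s] by (simp add: carre_du_champ_def singular_mean_def)

lemma integrable_carre_du_champ_integrand:
  assumes "0 < s" "s < 1"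
  shows "integrable lborel (carre_du_champ_integrand s u x)"
  using integrable_squared_difference[OF assms] carre_du_champ_reflect(1)[of 1 x s] by simp

text \<open>Inserting the Taylor expansion of \<phi> at \<open>u x\<close> for both shifted values
  splits the integrand into separately integrable pieces. The minus sign arises because the shifted
  values enter the fractional Laplacian negatively.\<close>

lemma
  assumes s: "0 < s" "s < 1"
  shows integrable_frac_laplacian_integrand_comp: "integrable lborel (frac_laplacian_integrand s (\<phi> \<circ> u) x)"
    and chain_remainder_eq: "chain_remainder U s u \<phi> x = - singular_mean (symmetric_remainder x) s"
proof -
  let ?N = "\<lambda>y::real^'n. norm y powr (real CARD('n) + 2 * s)"
  let ?p = "deriv_within U \<phi> (u x)" and ?c = "deriv_within U (deriv_within U \<phi>) (u x)"
  have eq: "frac_laplacian_integrand s (\<phi> \<circ> u) x = (\<lambda>y. ?p * (second_difference x y / ?N y)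
      - ?c / 2 * (squared_difference x y / ?N y)
      - ?c / 2 * (squared_difference x (- y) / ?N y)
      - symmetric_remainder x y / ?N y)"
  proof
    fix y
    have "2 * \<phi> (u x) - \<phi> (u (x + y)) - \<phi> (u (x - y)) = ?p * second_difference x y
      - ?c / 2 * squared_difference x y - ?c / 2 * squared_difference x (- y) - symmetric_remainder x y"
      by (simp add: second_difference_def squared_difference_def symmetric_remainder_def
          taylor_remainder_def power2_eq_square field_simps)
    then show "frac_laplacian_integrand s (\<phi> \<circ> u) x y = ?p * (second_difference x y / ?N y)
      - ?c / 2 * (squared_difference x y / ?N y)
      - ?c / 2 * (squared_difference x (- y) / ?N y)
      - symmetric_remainder x y / ?N y"
      by (simp add: frac_laplacian_integrand_def diff_divide_distrib)
  qed
  note int = integrable_second_difference[OF s, of x] integrable_squared_difference[OF s, of x]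
    integrable_symmetric_remainder[OF s, of x]
  have int': "integrable lborel (\<lambda>y. squared_difference x (- y) / ?N y)"
    using carre_du_champ_reflect(1)[of "- 1" x s] integrable_carre_du_champ_integrand[OF s] by simp
  show "integrable lborel (frac_laplacian_integrand s (\<phi> \<circ> u) x)"
    unfolding eq using int int'
    by (intro Bochner_Integration.integrable_diff integrable_mult_right) auto
  \<comment> \<open>Merges the two halves \<open>?c / 2\<close> into a single carre du champ with
    factor \<open>?c\<close>.\<close>
  have "(LINT y|lborel. squared_difference x (- y) / ?N y) = (LINT y|lborel. squared_difference x y / ?N y)"
    using carre_du_champ_reflect(2)[of "- 1" x s] carre_du_champ_reflect(2)[of 1 x s] by simp
  then have integral: "(LINT y|lborel. frac_laplacian_integrand s (\<phi> \<circ> u) x y) =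
      ?p * (LINT y|lborel. second_difference x y / ?N y)
      - ?c * (LINT y|lborel. squared_difference x y / ?N y) - (LINT y|lborel. symmetric_remainder x y / ?N y)"
    unfolding eq using int int'
    by (simp add: Bochner_Integration.integral_diff del: times_divide_eq_right times_divide_eq_left)
  show "chain_remainder U s u \<phi> x = - singular_mean (symmetric_remainder x) s"
    unfolding chain_remainder_def frac_laplacian_u carre_du_champ_u
    unfolding frac_laplacian_def singular_mean_def integral by (simp add: algebra_simps)
qed

text \<open>True for every \<open>s\<close> by the choice of the remainder; the analytic content
  lies in the integrability and limit statements.\<close>

lemma frac_laplacian_chain_rule:
  "frac_laplacian s (\<phi> \<circ> u) x = deriv_within U \<phi> (u x) * frac_laplacian s u x
     - deriv_within U (deriv_within U \<phi>) (u x) * carre_du_champ s u x + chain_remainder U s u \<phi> x"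
  by (simp add: chain_remainder_def)

lemma tendsto_chain_remainder: "((\<lambda>s. chain_remainder U s u \<phi> x) \<longlongrightarrow> 0) (at_left 1)"
proof (rule Lim_transform_eventually)
  show "((\<lambda>s. - singular_mean (symmetric_remainder x) s) \<longlongrightarrow> 0) (at_left 1)"
    using tendsto_minus[OF tendsto_symmetric_remainder] by simp
  show "\<forall>\<^sub>F s in at_left 1. - singular_mean (symmetric_remainder x) s = chain_remainder U s u \<phi> x"
    using eventually_at_left_1 by eventually_elim (simp add: chain_remainder_eq)
qed

lemma chain_remainder_quadratic:
  assumes "\<forall>t\<in>U. \<phi> t = a * t\<^sup>2 + b * t + c" "0 < s" "s < 1"
  shows "chain_remainder U s u \<phi> x = 0"
  using assms by (simp add: chain_remainder_eq singular_mean_def symmetric_remainder_def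
      taylor_remainder_quadratic[OF assms(1)])

lemma tendsto_frac_laplacian_comp:
  "((\<lambda>s. - frac_laplacian s (\<phi> \<circ> u) x) \<longlongrightarrow>
    deriv_within U \<phi> (u x) * laplacian u x
    + deriv_within U (deriv_within U \<phi>) (u x) * (norm (grad u x))\<^sup>2) (at_left 1)"
proof -
  have "((\<lambda>s. - frac_laplacian s (\<phi> \<circ> u) x) \<longlongrightarrow>
      - (deriv_within U \<phi> (u x) * - laplacian u x
        - deriv_within U (deriv_within U \<phi>) (u x) * (norm (grad u x))\<^sup>2 + 0)) (at_left 1)"
    unfolding frac_laplacian_chain_rule unfolding frac_laplacian_u carre_du_champ_u
    by (intro tendsto_intros tendsto_second_difference tendsto_squared_difference tendsto_chain_remainder)
  then show ?thesis
    by (simp add: add.commute)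
qed

end

text \<open>The integrability conjuncts ensure that the identity relates genuine integrals, since
  \<open>LINT\<close> is 0 by convention for a non-integrable function.\<close>

theorem proposition1p2:
  fixes U :: "real set" and \<phi> :: "real \<Rightarrow> real" and \<alpha> :: real
    and u :: "real ^ 'n::finite \<Rightarrow> real"
  assumes "is_interval U"
    and "\<alpha> > 0"
    and "C11_on U \<phi>"
    and "C2_holder_loc_on \<alpha> U \<phi>"
    and "u \<in> schwartz_space"
    and "range u \<subseteq> U"
  shows
    "(\<forall>s\<in>{0<..<1}. \<forall>x.
        integrable lborel (frac_laplacian_integrand s (\<phi> \<circ> u) x) \<and>
        integrable lborel (frac_laplacian_integrand s u x) \<and>
        integrable lborel (carre_du_champ_integrand s u x) \<and>
        frac_laplacian s (\<phi> \<circ> u) x =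
          deriv_within U \<phi> (u x) * frac_laplacian s u x
          - deriv_within U (deriv_within U \<phi>) (u x) * carre_du_champ s u x
          + chain_remainder U s u \<phi> x)
     \<and> (\<forall>x. ((\<lambda>s. chain_remainder U s u \<phi> x) \<longlongrightarrow> 0) (at_left 1))
     \<and> (\<forall>a b c. (\<forall>t\<in>U. \<phi> t = a * t\<^sup>2 + b * t + c) \<longrightarrow>
          (\<forall>s\<in>{0<..<1}. \<forall>x. chain_remainder U s u \<phi> x = 0))
     \<and> (\<forall>x. ((\<lambda>s. - frac_laplacian s (\<phi> \<circ> u) x) \<longlongrightarrow>
            deriv_within U \<phi> (u x) * laplacian u x
            + deriv_within U (deriv_within U \<phi>) (u x) * (norm (grad u x))\<^sup>2) (at_left 1))"
proof -
  interpret chain_rule U \<phi> u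
    using assms by unfold_locales (auto simp: C2_holder_loc_on_def)
  show ?thesis
    by (intro conjI ballI allI impI integrable_frac_laplacian_integrand_comp
        integrable_frac_laplacian_integrand_u integrable_carre_du_champ_integrand
        frac_laplacian_chain_rule tendsto_chain_remainder tendsto_frac_laplacian_comp
        chain_remainder_quadratic) auto
qed

end
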